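(* Let $m\ge n$ be positive integers, $d=\gcd(m,n)$, $m=m'd$, $n=n'd$. The number of straight lines of $\mathcal{L}$ (as defined in the context) can be decomposed as follows. (a) If $d$ is odd, it equals $$\frac{(m'-1)(n'-1)}{2}+\frac{d-1}{2}\big[(m'-1)n'+m'(n'-1)\big]+\frac{d-1}{2}\cdot 2m'n'+\binom{(d-1)/2}{2}\cdot 4m'n',$$ where the first summand is the number of straight lines intersecting $C_1$ twice, the second is the number of those intersecting some $C_{\zeta^i}$ with $i\ne0$ twice, the third is the number of those intersecting a pair $\{C_1,C_{\zeta^i}\}$ with $i\neq 0$ at two different points, and the fourth is the number of those intersecting a pair $\{C_{\zeta^i},C_{\zeta^j}\}$ of different components with $i,j\ne 0$ at two different points. (b) If $d$ is even, it equals $$\frac{(m'-1)(n'-1)}{2}+\frac{(m'-1)(n'-1)}{2}+\frac{d-2}{2}\big[(m'-1)n'+m'(n'-1)\big]+m'n'+\frac{d-2}{2}\cdot 2m'n'+\frac{d-2}{2}\cdot 2m'n'+\binom{(d-2)/2}{2}\cdot 4m'n',$$ where the first, second and third summands are the numbers of straight lines intersecting twice, respectively, $C_1$; $C_{-1}$; some $C_{\zeta^i}$ with $i\ne0,\frac d2$; and the fourth, fifth, sixth and seventh summands are the numbers of straight lines intersecting at two different points, respectively, the pair $\{C_1,C_{-1}\}$; a pair $\{C_1,C_{\zeta^i}\}$ with $i\neq 0,\frac d2$; a pair $\{C_{-1},C_{\zeta^i}\}$ with $i\neq0,\frac d2$; a pair $\{C_{\zeta^i},C_{\zeta^j}\}$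 of different components with $i,j\ne0,\frac d2$.
   Context: $G_{m,n}=\langle x,y\mid x^m=y^n\rangle$; its $SL(2,\mathbb{C})$-character variety is $X(G_{m,n})=\{(\operatorname{tr}\rho(x),\operatorname{tr}\rho(y),\operatorname{tr}\rho(xy))\mid\rho:G_{m,n}\to SL(2,\mathbb{C})\}\subseteq\mathbb{C}^3$, and $X(G_{m,n})=\mathcal{L}\cup\mathcal{C}$ with $\mathcal L,\mathcal C$ as follows. Polynomials in $\mathbb{C}[T]$: $f_0=2$, $f_1=T$, $f_k=Tf_{k-1}-f_{k-2}$; $s_0=0$, $s_1=s_2=1$, $s_3=T+1$, $s_k=Ts_{k-2}-s_{k-4}$; $\sigma_0=0$, $\sigma_1=\sigma_2=1$, $\sigma_3=T-1$, $\sigma_k=T\sigma_{k-2}-\sigma_{k-4}$. Ideals of $\mathbb{C}[X,Y,Z]$: $I_1=\langle s_m(X),s_n(Y)\rangle$; $I_2=\langle\sigma_m(X),\sigma_n(Y)\rangle$ if $m,n$ are odd, $\langle\sigma_m(X),f_{n/2}(Y)\rangle$ if $m$ is odd and $n$ even, $\langle f_{m/2}(X),\sigma_n(Y)\rangle$ if $m$ is even and $n$ odd, $\langle f_{m/2}(X),f_{n/2}(Y)\rangle$ if $m,n$ are even. $\mathcal{L}=V(I_1)\cup V(I_2)\subseteq\mathbb{C}^3$ is a finite union of pairwise disjoint straight lines $\{X=a,\ Y=b\}$, called the straight lines of $\mathcal L$. Let $\zeta$ be a primitive $d$-th root of unity and, for a $d$-th root of unity $\xi$, $C_\xi=\{(u+u^{-1},v+v^{-1},uv+(uv)^{-1})\mid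 u,v\in\mathbb{C}^*,\ u^{m'}=\xi v^{n'}\}$. $\mathcal{C}=\bigcup_{i=0}^{d-1}C_{\zeta^i}$; the distinct $C_{\zeta^i}$ are its irreducible components, they are pairwise disjoint, and $C_{\zeta^i}=C_{\zeta^j}$ iff $\zeta^i=\zeta^{\pm j}$. Each line of $\mathcal L$ meets $\mathcal C$ in exactly two points. A line intersects a component "twice" if both points lie on that component, and intersects a pair of different components at two different points if one point lies on each. *)

theory Defs
  imports Complex_Main "HOL-Computational_Algebra.Polynomial"
begin

fun poly_f :: "nat \<Rightarrow> complex poly" where
  "poly_f 0 = 2"
| "poly_f (Suc 0) = [:0, 1:]"
| "poly_f (Suc (Suc k)) = [:0, 1:] * poly_f (Suc k) - poly_f k"

fun poly_s :: "nat \<Rightarrow> complex poly" where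
  "poly_s 0 = 0"
| "poly_s (Suc 0) = 1"
| "poly_s (Suc (Suc 0)) = 1"
| "poly_s (Suc (Suc (Suc 0))) = [:0, 1:] + 1"
| "poly_s (Suc (Suc (Suc (Suc k)))) = [:0, 1:] * poly_s (Suc (Suc k)) - poly_s k"

fun poly_\<sigma> :: "nat \<Rightarrow> complex poly" where
  "poly_\<sigma> 0 = 0"
| "poly_\<sigma> (Suc 0) = 1"
| "poly_\<sigma> (Suc (Suc 0)) = 1"
| "poly_\<sigma> (Suc (Suc (Suc 0))) = [:0, 1:] - 1"
| "poly_\<sigma> (Suc (Suc (Suc (Suc k)))) = [:0, 1:] * poly_\<sigma> (Suc (Suc k)) - poly_\<sigma> k"

text \<open>The ring of polynomials in three variables over the complex numbers is represented as the
  iterated polynomial ring in which the innermost variable is the first coordinate of affine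
  3-space, and the outermost variable the third.\<close>

type_synonym poly3 = "complex poly poly poly"

type_synonym point3 = "complex \<times> complex \<times> complex"

definition const3 :: "complex \<Rightarrow> poly3" where
  "const3 c = [:[:[:c:]:]:]"

definition var_X :: poly3 where
  "var_X = [:[:[:0, 1:]:]:]"

definition var_Y :: poly3 where
  "var_Y = [:[:0, 1:]:]"

definition subst3 :: "complex poly \<Rightarrow> poly3 \<Rightarrow> poly3" where
  "subst3 g P = poly (map_poly const3 g) P"

definition eval3 :: "poly3 \<Rightarrow> point3 \<Rightarrow> complex" where
  "eval3 P = (\<lambda>(x, y, z). poly (poly (poly P [:[:z:]:]) [:y:]) x)"

text \<open>The ideal generated by a set is its span in the ring regarded as a module over itself.\<close>

definition ideal_gen :: "'a::comm_ring_1 set \<Rightarrow> 'a set" where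
  "ideal_gen B = module.span (*) B"

definition zero_locus :: "poly3 set \<Rightarrow> point3 set" where
  "zero_locus I = {p. \<forall>P\<in>I. eval3 P p = 0}"

definition ideal_I1 :: "nat \<Rightarrow> nat \<Rightarrow> poly3 set" where
  "ideal_I1 m n = ideal_gen {subst3 (poly_s m) var_X, subst3 (poly_s n) var_Y}"

definition ideal_I2 :: "nat \<Rightarrow> nat \<Rightarrow> poly3 set" where
  "ideal_I2 m n = ideal_gen
     {subst3 (if odd m then poly_\<sigma> m else poly_f (m div 2)) var_X,
      subst3 (if odd n then poly_\<sigma> n else poly_f (n div 2)) var_Y}"

definition line_locus :: "nat \<Rightarrow> nat \<Rightarrow> point3 set" where
  "line_locus m n = zero_locus (ideal_I1 m n) \<union> zero_locus (ideal_I2 m n)"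

definition straight_lines :: "nat \<Rightarrow> nat \<Rightarrow> point3 set set" where
  "straight_lines m n =
     {l. (\<exists>a b. l = {(x, y, z). x = a \<and> y = b}) \<and> l \<subseteq> line_locus m n}"

definition primitive_root_of_unity :: "nat \<Rightarrow> complex \<Rightarrow> bool" where
  "primitive_root_of_unity d \<zeta> \<longleftrightarrow> \<zeta> ^ d = 1 \<and> (\<forall>k. 0 < k \<and> k < d \<longrightarrow> \<zeta> ^ k \<noteq> 1)"

definition C_component :: "nat \<Rightarrow> nat \<Rightarrow> complex \<Rightarrow> point3 set" where
  "C_component m' n' \<xi> =
     {(u + inverse u, v + inverse v, u * v + inverse (u * v)) | u v.
        u \<noteq> 0 \<and> v \<noteq> 0 \<and> u ^ m' = \<xi> * v ^ n'}"

text \<open>The two notions below are meant for lines \<open>l\<close> that meet \<open>C\<close>, the union of all the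
  components, in exactly two points; this requirement is part of the definitions.\<close>

definition meets_twice :: "point3 set \<Rightarrow> point3 set \<Rightarrow> point3 set \<Rightarrow> bool" where
  "meets_twice C l K \<longleftrightarrow> (\<exists>p q. p \<noteq> q \<and> l \<inter> C = {p, q} \<and> p \<in> K \<and> q \<in> K)"

definition meets_pair :: "point3 set \<Rightarrow> point3 set \<Rightarrow> point3 set \<Rightarrow> point3 set \<Rightarrow> bool" where
  "meets_pair C l K K' \<longleftrightarrow>
     K \<noteq> K' \<and> (\<exists>p q. p \<noteq> q \<and> l \<inter> C = {p, q} \<and> p \<in> K \<and> q \<in> K')"

end

theory Submission
  imports Defs
begin

text \<open>
  Write the first two coordinates of a point as \<open>t + 1/t\<close>. At such an argument the polynomial
  \<open>s\<^sub>m\<close> is, up to a nonvanishing factor, \<open>t\<^sup>m - 1\<close> with the roots 1 and -1 removed, and the generators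
  of the second ideal are \<open>t\<^sup>m + 1\<close> with the root -1 removed. Hence the straight lines are
  \<open>X = 2 cos (\<pi> i / m)\<close>, \<open>Y = 2 cos (\<pi> j / n)\<close> with \<open>0 < i < m\<close>, \<open>0 < j < n\<close> and \<open>i\<close>, \<open>j\<close> of the same
  parity, even for the first ideal and odd for the second (\<open>straight_lines_eq\<close>).

  Let \<open>a\<close> and \<open>b\<close> be the unit complex numbers of arguments \<open>\<pi> i / m\<close> and \<open>\<pi> j / n\<close>. The points of a
  component are images of pairs \<open>(u, v)\<close> under a map that identifies \<open>(u, v)\<close> with \<open>(1/u, 1/v)\<close>,
  so the line can meet the components only in the images of \<open>(a, b)\<close> and of \<open>(a, 1/b)\<close>. These are
  different points, because neither \<open>a\<close> nor \<open>b\<close> is 1 or -1. The first one lies on \<open>C\<^sub>\<xi>\<close> exactly if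
  \<open>\<xi>\<close> or \<open>1/\<xi>\<close> is the unit complex number of argument \<open>\<pi> (i - j) / d\<close>, the second one exactly if
  \<open>\<xi>\<close> or \<open>1/\<xi>\<close> is that of argument \<open>\<pi> (i + j) / d\<close> (\<open>line_meets_components\<close>). All incidence
  conditions thus turn into divisibility of \<open>i - j\<close>, \<open>i + j\<close>, \<open>i\<close> and \<open>j\<close> by \<open>d\<close> and \<open>2d\<close>.

  Counting the index pairs is done by cutting the ranges of \<open>i\<close> and \<open>j\<close> into blocks of length
  \<open>d\<close>, each of which contains the same number of solutions (\<open>card_blocks\<close>). Only the lines that join
  two different components \<open>C\<^sub>\<xi>\<close>, \<open>C\<^sub>\<eta>\<close> with nonreal \<open>\<xi>\<close>, \<open>\<eta>\<close> are counted otherwise, by subtraction: the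
  seven kinds of incidence partition the index pairs (\<open>classes_partition\<close>), and the number of all
  index pairs is elementary. The parities of \<open>d\<close> are treated together. In both cases there are
  \<open>(d - 1) div 2\<close> pairs \<open>{\<xi>, 1/\<xi>}\<close> of nonreal \<open>d\<close>-th roots of unity, and if \<open>d\<close> is odd, the three kinds of
  incidence that involve -1 do not occur (\<open>odd_no_minus_one\<close>).
\<close>

section \<open>Zeros of the three polynomial sequences\<close>

text \<open>The sequence advances in steps of two, so a square root \<open>r\<close> of \<open>t\<close> is needed: with \<open>w = 1/r\<close>, both
  \<open>r\<^sup>k\<close> and \<open>w\<^sup>k\<close> satisfy the same recursion \<open>x\<^sub>k\<^sub>+\<^sub>4 = (t + 1/t) x\<^sub>k\<^sub>+\<^sub>2 - x\<^sub>k\<close>. The normalising factor depends on the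
  parity of \<open>k\<close> because the two interleaved subsequences have different initial values.\<close>

lemma poly_s_at_sum:
  fixes r w :: complex
  assumes "r * w = 1"
  shows "poly (poly_s k) (r^2 + w^2) * (if even k then r^2 - w^2 else r - w) = r^k - w^k"
proof (induction k rule: poly_s.induct)
  case (5 k)
  have rw: "r^2 * w^2 = 1" using assms by (metis power_mult_distrib power_one)
  let ?g = "if even k then r^2 - w^2 else r - w"
  have "poly (poly_s (Suc (Suc (Suc (Suc k))))) (r^2 + w^2) * ?g
      = (r^2 + w^2) * (poly (poly_s (Suc (Suc k))) (r^2 + w^2) * ?g)
        - poly (poly_s k) (r^2 + w^2) * ?g"
    by (simp add: algebra_simps)
  also have "\<dots> = (r^2 + w^2) * (r^(k+2) - w^(k+2)) - (r^k - w^k)"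
    using 5 by simp
  also have "\<dots> = r^(k+4) - w^(k+4) + (r^2 * w^2 - 1) * (r^k - w^k)"
    by (simp add: algebra_simps power_add power2_eq_square eval_nat_numeral)
  finally show ?case using rw by (simp add: power4_eq_xxxx power_add mult_ac)
next
  case 4
  have "(r^2 + w^2 + r * w) * (r - w) = r^3 - w^3"
    by (simp add: algebra_simps power2_eq_square power3_eq_cube)
  with assms show ?case by (simp add: numeral_3_eq_3)
qed (simp_all add: power2_eq_square)

lemma poly_\<sigma>_at_sum:
  fixes r w :: complex
  assumes "r * w = 1" and "odd k"
  shows "poly (poly_\<sigma> k) (r^2 + w^2) * (r + w) = r^k + w^k"
  using assms(2)
proof (induction k rule: poly_\<sigma>.induct)
  case (5 k)
  have rw: "r^2 * w^2 = 1" using assms by (metis power_mult_distrib power_one)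
  have "poly (poly_\<sigma> (Suc (Suc (Suc (Suc k))))) (r^2 + w^2) * (r + w)
      = (r^2 + w^2) * (poly (poly_\<sigma> (Suc (Suc k))) (r^2 + w^2) * (r + w))
        - poly (poly_\<sigma> k) (r^2 + w^2) * (r + w)"
    by (simp add: algebra_simps)
  also have "\<dots> = (r^2 + w^2) * (r^(k+2) + w^(k+2)) - (r^k + w^k)"
    using 5 by simp
  also have "\<dots> = r^(k+4) + w^(k+4) + (r^2 * w^2 - 1) * (r^k + w^k)"
    by (simp add: algebra_simps power_add power2_eq_square eval_nat_numeral)
  finally show ?case using rw by (simp add: power4_eq_xxxx power_add mult_ac)
qed (use assms in \<open>auto simp: algebra_simps power2_eq_square eval_nat_numeral\<close>)

lemma poly_f_at_sum:
  fixes t w :: complex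
  assumes "t * w = 1"
  shows "poly (poly_f k) (t + w) = t^k + w^k"
proof (induction k rule: poly_f.induct)
  case (3 k)
  have "(t + w) * (t^(k+1) + w^(k+1)) - (t^k + w^k)
      = t^(k+2) + w^(k+2) + (t * w - 1) * (t^k + w^k)"
    by (simp add: algebra_simps power_add power2_eq_square eval_nat_numeral)
  with 3 assms show ?case by (auto simp: algebra_simps)
qed auto

text \<open>At \<open>t = 1\<close> and \<open>t = -1\<close> the factors in the preceding identities may vanish, so the values there, at
  \<open>t + 1/t = 2\<close> and \<open>t + 1/t = -2\<close>, need separate computations. All that matters of them is that
  they are nonzero for positive \<open>k\<close>.\<close>

lemma poly_s_at_2: "poly (poly_s k) 2 = (if even k then of_nat (k div 2) else of_nat k)"
  by (induction k rule: poly_s.induct) auto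

lemma poly_s_at_minus_2:
  "poly (poly_s k) (-2) = (if even k then - ((-1) ^ (k div 2)) * of_nat (k div 2) else (-1) ^ (k div 2))"
  by (induction k rule: poly_s.induct) (auto simp: algebra_simps)

lemma poly_\<sigma>_at_2: "odd k \<Longrightarrow> poly (poly_\<sigma> k) 2 = 1"
  by (induction k rule: poly_\<sigma>.induct) auto

lemma poly_\<sigma>_at_minus_2: "odd k \<Longrightarrow> poly (poly_\<sigma> k) (-2) = (-1) ^ (k div 2) * of_nat k"
proof (induction k rule: poly_\<sigma>.induct)
  case (5 k)
  then have "poly (poly_\<sigma> (Suc (Suc k))) (-2) = (-1) ^ Suc (k div 2) * of_nat (k + 2)"
    "poly (poly_\<sigma> k) (-2) = (-1) ^ (k div 2) * of_nat k" by auto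
  moreover have "poly (poly_\<sigma> (Suc (Suc (Suc (Suc k))))) (-2)
      = -2 * poly (poly_\<sigma> (Suc (Suc k))) (-2) - poly (poly_\<sigma> k) (-2)" by simp
  ultimately have "poly (poly_\<sigma> (Suc (Suc (Suc (Suc k))))) (-2)
      = -2 * ((-1) ^ Suc (k div 2) * of_nat (k + 2)) - (-1) ^ (k div 2) * of_nat k" by presburger
  then show ?case by (simp add: algebra_simps)
qed auto

lemma poly_s_zero_iff:
  fixes t :: complex
  assumes "t \<noteq> 0" and "0 < m"
  shows "poly (poly_s m) (t + inverse t) = 0 \<longleftrightarrow> t^m = 1 \<and> t^2 \<noteq> 1"
proof (cases "t^2 = 1")
  case True
  then have "t = 1 \<or> t = -1" by (simp add: power2_eq_1_iff)
  with True \<open>0 < m\<close> show ?thesis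
    by (auto simp: poly_s_at_2 poly_s_at_minus_2 elim!: evenE split: if_splits)
next
  case False
  define r where "r = csqrt t"
  define w where "w = inverse r"
  have t: "t = r^2" by (simp add: r_def)
  have r0: "r \<noteq> 0" using assms t by auto
  have rw: "r * w = 1" using r0 by (simp add: w_def)
  have it: "inverse t = w^2" by (simp add: t w_def power_inverse)
  have "r^2 \<noteq> w^2"
    using False r0 by (auto simp: t w_def field_simps power2_eq_square)
  moreover from this have "r \<noteq> w" by auto
  ultimately have "poly (poly_s m) (t + inverse t) = 0 \<longleftrightarrow> r^m - w^m = 0"
    using poly_s_at_sum[OF rw, of m] by (auto simp: t it[unfolded t] split: if_splits)
  also have "\<dots> \<longleftrightarrow> t^m = 1"
    using r0 by (auto simp: t w_def field_simps power2_eq_square power_mult_distrib)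
  finally show ?thesis using False by simp
qed

text \<open>The common name for the generators of the second ideal: for both parities of \<open>m\<close> it is the
  polynomial in \<open>t + 1/t\<close> that encodes \<open>t\<^sup>m = -1\<close>, in the way in which \<open>s\<^sub>m\<close> encodes \<open>t\<^sup>m = 1\<close>.\<close>

definition twisted_poly :: "nat \<Rightarrow> complex poly" where
  "twisted_poly m = (if odd m then poly_\<sigma> m else poly_f (m div 2))"

lemma twisted_poly_zero_iff:
  fixes t :: complex
  assumes "t \<noteq> 0" and "0 < m"
  shows "poly (twisted_poly m) (t + inverse t) = 0 \<longleftrightarrow> t^m = -1 \<and> t^2 \<noteq> 1"
proof (cases "odd m")
  case True
  show ?thesis
  proof (cases "t^2 = 1")
    case t2: True
    then have "t = 1 \<or> t = -1" by (simp add: power2_eq_1_iff)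
    with t2 \<open>0 < m\<close> True show ?thesis
      by (auto simp: twisted_poly_def poly_\<sigma>_at_2 poly_\<sigma>_at_minus_2)
  next
    case False
    define r where "r = csqrt t"
    define w where "w = inverse r"
    have t: "t = r^2" by (simp add: r_def)
    have r0: "r \<noteq> 0" using assms t by auto
    have rw: "r * w = 1" using r0 by (simp add: w_def)
    have it: "inverse t = w^2" by (simp add: t w_def power_inverse)
    have "r + w \<noteq> 0"
    proof
      assume "r + w = 0"
      then have "r * (r + w) = 0" by simp
      then have "t = -1" using rw by (simp add: t algebra_simps power2_eq_square eq_neg_iff_add_eq_0)
      with False show False by simp
    qed
    then have "poly (twisted_poly m) (t + inverse t) = 0 \<longleftrightarrow> r^m + w^m = 0"
      using poly_\<sigma>_at_sum[OF rw True] True by (auto simp: t it[unfolded t] twisted_poly_def)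
    also have "\<dots> \<longleftrightarrow> r^m * (r^m + w^m) = 0" using r0 by simp
    also have "r^m * (r^m + w^m) = t^m + 1"
      using rw by (simp add: t algebra_simps flip: power_mult_distrib) (simp add: power2_eq_square)
    also have "t^m + 1 = 0 \<longleftrightarrow> t^m = -1" by (simp add: eq_neg_iff_add_eq_0)
    finally show ?thesis using False by simp
  qed
next
  case False
  then obtain k where k: "m = 2 * k" by auto
  have "poly (twisted_poly m) (t + inverse t) = t^k + inverse t^k"
    using assms poly_f_at_sum[of t "inverse t" k] by (simp add: twisted_poly_def k)
  then have "poly (twisted_poly m) (t + inverse t) = 0 \<longleftrightarrow> t^k * (t^k + inverse t^k) = 0"
    using assms by simp
  also have "t^k * (t^k + inverse t^k) = t^m + 1"
    using assms by (simp add: k distrib_left mult_2 power_add flip: power_mult_distrib)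
  also have "t^m + 1 = 0 \<longleftrightarrow> t^m = -1" by (simp add: eq_neg_iff_add_eq_0)
  also have "\<dots> \<longleftrightarrow> t^m = -1 \<and> t^2 \<noteq> 1" by (auto simp: k power_mult)
  finally show ?thesis .
qed

section \<open>The zeros as values of the cosine\<close>

text \<open>The form \<open>t + 1/t\<close> is the one in which the zeros of the polynomials appear; \<open>node_eq_cos\<close> identifies
  the number as \<open>2 cos (\<pi> i / m)\<close>.\<close>

definition node :: "nat \<Rightarrow> nat \<Rightarrow> complex" where
  "node m i = cis (pi * i / m) + inverse (cis (pi * i / m))"

lemma node_eq_cos: "node m i = of_real (2 * cos (pi * i / m))"
  by (simp add: node_def complex_eq_iff)

lemma inj_on_node: "inj_on (node m) {..m}"
proof (cases "m = 0")
  case False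
  show ?thesis
  proof (rule inj_onI)
    fix i j assume ij: "i \<in> {..m}" "j \<in> {..m}" "node m i = node m j"
    then have "cos (pi * i / m) = cos (pi * j / m)"
      by (simp add: node_eq_cos flip: of_real_mult)
    moreover have "0 \<le> pi * i / m \<and> pi * i / m \<le> pi" "0 \<le> pi * j / m \<and> pi * j / m \<le> pi"
      using ij False by (simp_all add: field_simps)
    ultimately have "pi * i / m = pi * j / m" by (meson cos_inj_pi)
    then show "i = j" using False by simp
  qed
qed auto

lemma ex_sum_inverse: "\<exists>t::complex. t \<noteq> 0 \<and> x = t + inverse t"
proof -
  define t where "t = (x + csqrt (x^2 - 4)) / 2"
  have "(csqrt (x^2 - 4))^2 = x^2 - 4" by simp
  moreover have "csqrt (x^2 - 4) = 2 * t - x" by (simp add: t_def field_simps)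
  ultimately have "(2 * t - x)^2 = x^2 - 4" by simp
  then have "4 * (t * (x - t)) = 4 * 1" by (simp add: power2_eq_square algebra_simps)
  then have "t * (x - t) = 1" by (subst (asm) mult_left_cancel) auto
  then have "t \<noteq> 0" "inverse t = x - t" by (auto simp: inverse_unique)
  then show ?thesis by (intro exI[of _ t]) auto
qed

lemma cis_node_power:
  assumes "0 < m"
  shows "cis (pi * real i / real m) ^ m = (-1) ^ i"
proof -
  have "cis (pi * real i / real m) ^ m = cis (real i * pi)"
    using assms by (simp add: DeMoivre mult.commute)
  also have "\<dots> = cis pi ^ i" by (simp only: DeMoivre)
  finally show ?thesis by simp
qed

lemma cis_node_square:
  assumes "0 < i" "i < m"
  shows "cis (pi * real i / real m) ^ 2 \<noteq> 1"
proof
  assume "cis (pi * real i / real m) ^ 2 = 1"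
  then have "cis (pi * real i / real m) = 1 \<or> cis (pi * real i / real m) = -1"
    by (simp add: power2_eq_1_iff)
  then have "sin (pi * real i / real m) = 0" by (auto simp: complex_eq_iff)
  moreover have "sin (pi * real i / real m) > 0"
    using assms by (intro sin_gt_zero) (auto simp: divide_simps)
  ultimately show False by simp
qed

text \<open>Such a \<open>t\<close> is \<open>exp (\<i> \<pi> k / m)\<close> with \<open>0 < k < 2m\<close> and \<open>k \<noteq> m\<close>. Replacing \<open>t\<close> by \<open>1/t\<close>, that is \<open>k\<close> by
  \<open>2m - k\<close>, changes neither the sum nor the parity of \<open>k\<close>, so the index can be taken below \<open>m\<close>. The
  last conjunct makes the parity of the index tell which of the two sequences has the zero.\<close>

lemma ex_node:
  fixes t :: complex
  assumes "0 < m" "t ^ (2 * m) = 1" "t^2 \<noteq> 1"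
  shows "\<exists>i. 0 < i \<and> i < m \<and> t + inverse t = node m i \<and> t^m = (-1)^i"
proof -
  have "t \<in> (\<lambda>k. cis (2 * pi * real k / real (2 * m))) ` {..<2 * m}"
    using bij_betw_imp_surj_on[OF bij_betw_roots_unity[of "2 * m"]] assms by auto
  then obtain k where k: "k < 2 * m" "t = cis (pi * k / m)" by auto
  have k0: "k \<noteq> 0" using assms(3) k(2) by (intro notI) simp
  have km: "k \<noteq> m" using assms k(2) by (intro notI) simp
  have tm: "t^m = (-1)^k" using cis_node_power[OF assms(1)] k by simp
  show ?thesis
  proof (cases "k < m")
    case True
    then show ?thesis using k k0 tm by (intro exI[of _ k]) (auto simp: node_def)
  next
    case False
    define i where "i = 2 * m - k"
    have "pi * i / m = 2 * pi - pi * k / m"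
      using k assms by (simp add: i_def field_simps of_nat_diff)
    then have "cis (pi * i / m) = inverse t"
      using k by (simp add: complex_eq_iff cos_diff sin_diff)
    then have "t + inverse t = node m i" by (simp add: node_def)
    moreover have "(-1::complex)^i = (-1)^k"
      using k by (auto simp: i_def minus_one_power_iff)
    ultimately show ?thesis using False km k tm by (intro exI[of _ i]) (auto simp: i_def)
  qed
qed

lemma zeros_poly_s:
  assumes "0 < m"
  shows "poly (poly_s m) x = 0 \<longleftrightarrow> (\<exists>i. 0 < i \<and> i < m \<and> even i \<and> x = node m i)"
proof
  assume L: "poly (poly_s m) x = 0"
  obtain t where t: "t \<noteq> 0" "x = t + inverse t" using ex_sum_inverse by blast
  with L assms have tm: "t^m = 1" "t^2 \<noteq> 1" by (auto simp: poly_s_zero_iff)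
  then have "t^(2*m) = 1" by (simp add: power_mult mult.commute[of 2 m])
  from ex_node[OF assms this tm(2)] show "\<exists>i. 0 < i \<and> i < m \<and> even i \<and> x = node m i"
    using t tm by (auto simp: minus_one_power_iff split: if_splits)
next
  assume "\<exists>i. 0 < i \<and> i < m \<and> even i \<and> x = node m i"
  then obtain i where i: "0 < i" "i < m" "even i" "x = node m i" by blast
  show "poly (poly_s m) x = 0"
    unfolding i(4) node_def
    by (subst poly_s_zero_iff) (use i assms in \<open>auto simp: cis_node_power cis_node_square\<close>)
qed

lemma zeros_twisted_poly:
  assumes "0 < m"
  shows "poly (twisted_poly m) x = 0 \<longleftrightarrow> (\<exists>i. 0 < i \<and> i < m \<and> odd i \<and> x = node m i)"
proof
  assume L: "poly (twisted_poly m) x = 0"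
  obtain t where t: "t \<noteq> 0" "x = t + inverse t" using ex_sum_inverse by blast
  with L assms have tm: "t^m = -1" "t^2 \<noteq> 1" by (auto simp: twisted_poly_zero_iff)
  then have "t^(2*m) = 1" by (simp add: power_mult mult.commute[of 2 m])
  from ex_node[OF assms this tm(2)] show "\<exists>i. 0 < i \<and> i < m \<and> odd i \<and> x = node m i"
    using t tm by (auto simp: minus_one_power_iff split: if_splits)
next
  assume "\<exists>i. 0 < i \<and> i < m \<and> odd i \<and> x = node m i"
  then obtain i where i: "0 < i" "i < m" "odd i" "x = node m i" by blast
  show "poly (twisted_poly m) x = 0"
    unfolding i(4) node_def
    by (subst twisted_poly_zero_iff) (use i assms in \<open>auto simp: cis_node_power cis_node_square\<close>)
qed

section \<open>The straight lines\<close>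

lemma eval3_0: "eval3 0 p = 0"
  and eval3_add: "eval3 (P + Q) p = eval3 P p + eval3 Q p"
  and eval3_mult: "eval3 (P * Q) p = eval3 P p * eval3 Q p"
  by (auto simp: eval3_def split: prod.splits)

lemma eval3_subst3: "eval3 (subst3 g V) p = poly g (eval3 V p)"
proof (induction g)
  case (pCons a g)
  have "eval3 (const3 a) p = a" by (auto simp: eval3_def const3_def split: prod.splits)
  moreover have "subst3 (pCons a g) V = const3 a + V * subst3 g V"
    using pCons by (simp add: subst3_def map_poly_pCons const3_def)
  ultimately show ?case using pCons by (simp add: eval3_add eval3_mult)
qed (simp add: subst3_def eval3_0)

text \<open>Evaluation at a point is a ring homomorphism, so its kernel is an ideal and contains the ideal
  generated by any set on which it vanishes.\<close>

lemma zero_locus_ideal_gen: "zero_locus (ideal_gen B) = {p. \<forall>P\<in>B. eval3 P p = 0}"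
proof -
  interpret module "(*) :: poly3 \<Rightarrow> poly3 \<Rightarrow> poly3"
    by standard (simp_all add: algebra_simps)
  have "eval3 P p = 0" if "\<forall>P\<in>B. eval3 P p = 0" "P \<in> span B" for P p
    using that(2) by (induction rule: span_induct_alt) (use that in \<open>auto simp: eval3_0 eval3_add eval3_mult\<close>)
  then show ?thesis
    by (auto simp: zero_locus_def ideal_gen_def intro: span_base)
qed

definition vertical_line :: "complex \<Rightarrow> complex \<Rightarrow> point3 set" where
  "vertical_line a b = {(x, y, z). x = a \<and> y = b}"

lemma vertical_line_eq_iff: "vertical_line a b = vertical_line a' b' \<longleftrightarrow> a = a' \<and> b = b'"
  by (auto simp: vertical_line_def set_eq_iff)

definition index_pairs :: "nat \<Rightarrow> nat \<Rightarrow> (nat \<times> nat) set" where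
  "index_pairs m n = {(i, j). 0 < i \<and> i < m \<and> 0 < j \<and> j < n \<and> even (i + j)}"

definition node_line :: "nat \<Rightarrow> nat \<Rightarrow> nat \<times> nat \<Rightarrow> point3 set" where
  "node_line m n = (\<lambda>(i, j). vertical_line (node m i) (node n j))"

lemma finite_index_pairs: "finite (index_pairs m n)"
  by (rule finite_subset[of _ "{..<m} \<times> {..<n}"]) (auto simp: index_pairs_def)

lemma inj_on_node_line: "inj_on (node_line m n) (index_pairs m n)"
  by (rule inj_onI)
    (auto simp: node_line_def index_pairs_def vertical_line_eq_iff
       dest!: inj_onD[OF inj_on_node])

lemma line_locus_iff:
  assumes "0 < m" "0 < n"
  shows "(x, y, z) \<in> line_locus m n \<longleftrightarrow>
    (\<exists>i j. (i, j) \<in> index_pairs m n \<and> x = node m i \<and> y = node n j)"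
proof -
  have "(x, y, z) \<in> line_locus m n \<longleftrightarrow>
    poly (poly_s m) x = 0 \<and> poly (poly_s n) y = 0 \<or>
    poly (twisted_poly m) x = 0 \<and> poly (twisted_poly n) y = 0"
    unfolding line_locus_def ideal_I1_def ideal_I2_def zero_locus_ideal_gen
      twisted_poly_def[symmetric]
    by (simp add: eval3_subst3) (simp add: eval3_def var_X_def var_Y_def)
  also have "\<dots> \<longleftrightarrow> (\<exists>i j. (i, j) \<in> index_pairs m n \<and> x = node m i \<and> y = node n j)"
    unfolding zeros_poly_s[OF assms(1)] zeros_poly_s[OF assms(2)]
      zeros_twisted_poly[OF assms(1)] zeros_twisted_poly[OF assms(2)] index_pairs_def
      mem_Collect_eq prod.case even_add
    by blast
  finally show ?thesis .
qed

text \<open>The third coordinate is unconstrained in the zero loci, so a vertical line lies in their union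
  as soon as one of its points does.\<close>

lemma straight_lines_eq:
  assumes "0 < m" "0 < n"
  shows "straight_lines m n = node_line m n ` index_pairs m n"
proof -
  have "vertical_line a b \<subseteq> line_locus m n \<longleftrightarrow>
    (\<exists>i j. (i, j) \<in> index_pairs m n \<and> a = node m i \<and> b = node n j)" for a b
    using line_locus_iff[OF assms] by (auto simp: vertical_line_def subset_iff)
  then have "l \<in> straight_lines m n \<longleftrightarrow> (\<exists>i j. (i, j) \<in> index_pairs m n \<and>
      l = vertical_line (node m i) (node n j))" for l
    unfolding straight_lines_def vertical_line_def[symmetric] mem_Collect_eq by metis
  then show ?thesis
    by (auto simp: node_line_def image_iff Bex_def)
qed

section \<open>Points of a straight line on the components\<close>

lemma sum_inverse_eq_iff:
  fixes u a :: complex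
  assumes "u \<noteq> 0" "a \<noteq> 0"
  shows "u + inverse u = a + inverse a \<longleftrightarrow> u = a \<or> u = inverse a"
proof -
  have "u * a * ((u + inverse u) - (a + inverse a)) = (u - a) * (u * a - 1)"
    using assms by (simp add: field_simps)
  then have "u + inverse u = a + inverse a \<longleftrightarrow> (u - a) * (u * a - 1) = 0"
    using assms by (metis eq_iff_diff_eq_0 mult_eq_0_iff)
  also have "u * a - 1 = 0 \<longleftrightarrow> u = inverse a"
    using assms by (simp add: field_simps)
  then have "(u - a) * (u * a - 1) = 0 \<longleftrightarrow> u = a \<or> u = inverse a" by simp
  finally show ?thesis .
qed

definition torus_point :: "complex \<Rightarrow> complex \<Rightarrow> point3" where
  "torus_point u v = (u + inverse u, v + inverse v, u * v + inverse (u * v))"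

lemma torus_point_inverse: "torus_point (inverse u) (inverse v) = torus_point u v"
  by (simp add: torus_point_def)

lemma C_component_eq:
  "C_component M N \<xi> = {torus_point u v | u v. u \<noteq> 0 \<and> v \<noteq> 0 \<and> u ^ M = \<xi> * v ^ N}"
  by (simp add: C_component_def torus_point_def)

text \<open>The third coordinates of the two points differ by \<open>(u - 1/u) (v - 1/v)\<close>.\<close>

lemma torus_point_flip_neq:
  assumes "u \<noteq> 0" "v \<noteq> 0" "u^2 \<noteq> 1" "v^2 \<noteq> 1"
  shows "torus_point u v \<noteq> torus_point u (inverse v)"
proof
  assume "torus_point u v = torus_point u (inverse v)"
  then have "u * v + inverse (u * v) = u * inverse v + inverse (u * inverse v)"
    by (simp add: torus_point_def)
  then have "(u^2 - 1) * (v^2 - 1) = 0"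
    using assms by (simp add: field_simps power2_eq_square)
  with assms show False by simp
qed

lemma torus_point_in_line_iff:
  assumes "u \<noteq> 0" "v \<noteq> 0" "a \<noteq> 0" "b \<noteq> 0"
  shows "torus_point u v \<in> vertical_line (a + inverse a) (b + inverse b) \<longleftrightarrow>
    (u = a \<or> u = inverse a) \<and> (v = b \<or> v = inverse b)"
  using assms by (simp add: torus_point_def vertical_line_def sum_inverse_eq_iff)

text \<open>The first two coordinates determine \<open>u\<close> and \<open>v\<close> up to inversion of each; the third one forces both
  to be inverted together.\<close>

lemma torus_point_eq_iff:
  assumes "a \<noteq> 0" "b \<noteq> 0" "a^2 \<noteq> 1" "b^2 \<noteq> 1" "u \<noteq> 0" "v \<noteq> 0"
  shows "torus_point u v = torus_point a b \<longleftrightarrow>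
    u = a \<and> v = b \<or> u = inverse a \<and> v = inverse b"
proof
  assume eq: "torus_point u v = torus_point a b"
  then have "torus_point u v \<in> vertical_line (a + inverse a) (b + inverse b)"
    by (simp add: torus_point_def vertical_line_def)
  then have "(u = a \<or> u = inverse a) \<and> (v = b \<or> v = inverse b)"
    using assms by (simp add: torus_point_in_line_iff)
  moreover have "torus_point a (inverse b) \<noteq> torus_point a b"
    "torus_point (inverse a) b \<noteq> torus_point a b"
    using torus_point_flip_neq[of a b] torus_point_inverse[of a "inverse b"] assms by auto
  ultimately show "u = a \<and> v = b \<or> u = inverse a \<and> v = inverse b"
    using eq by auto
qed (auto simp: torus_point_inverse)

text \<open>A point has only the two preimages \<open>(a, b)\<close> and \<open>(1/a, 1/b)\<close>, and the equation that defines the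
  component determines \<open>\<xi>\<close> from each of them; the two values are inverse to each other.\<close>

lemma torus_point_in_component_iff:
  assumes "a \<noteq> 0" "b \<noteq> 0" "a^2 \<noteq> 1" "b^2 \<noteq> 1"
  shows "torus_point a b \<in> C_component M N \<xi> \<longleftrightarrow> \<xi> \<in> {a^M / b^N, inverse (a^M / b^N)}"
proof -
  have "torus_point a b \<in> C_component M N \<xi> \<longleftrightarrow>
    a^M = \<xi> * b^N \<or> inverse a ^ M = \<xi> * inverse b ^ N"
  proof
    assume "torus_point a b \<in> C_component M N \<xi>"
    then obtain u v where uv: "torus_point u v = torus_point a b"
      "u \<noteq> 0" "v \<noteq> 0" "u^M = \<xi> * v^N"
      unfolding C_component_eq mem_Collect_eq by metis
    then show "a^M = \<xi> * b^N \<or> inverse a ^ M = \<xi> * inverse b ^ N"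
      using torus_point_eq_iff[OF assms uv(2,3)] by auto
  next
    assume "a^M = \<xi> * b^N \<or> inverse a ^ M = \<xi> * inverse b ^ N"
    then show "torus_point a b \<in> C_component M N \<xi>"
    proof
      assume "inverse a ^ M = \<xi> * inverse b ^ N"
      then have "torus_point (inverse a) (inverse b) \<in> C_component M N \<xi>"
        unfolding C_component_eq mem_Collect_eq using assms
        by (intro exI[of _ "inverse a"] exI[of _ "inverse b"]) simp
      then show ?thesis by (simp add: torus_point_inverse)
    qed (use assms in \<open>auto simp: C_component_eq\<close>)
  qed
  also have "\<dots> \<longleftrightarrow> \<xi> \<in> {a^M / b^N, inverse (a^M / b^N)}"
    using assms by (auto simp: field_simps)
  finally show ?thesis .
qed

lemma line_inter_component_subset:
  assumes "a \<noteq> 0" "b \<noteq> 0"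
  shows "vertical_line (a + inverse a) (b + inverse b) \<inter> C_component M N \<xi>
    \<subseteq> {torus_point a b, torus_point a (inverse b)}"
proof
  fix p assume p: "p \<in> vertical_line (a + inverse a) (b + inverse b) \<inter> C_component M N \<xi>"
  then obtain u v where uv: "p = torus_point u v" "u \<noteq> 0" "v \<noteq> 0"
    by (auto simp: C_component_eq)
  with p assms have "(u = a \<or> u = inverse a) \<and> (v = b \<or> v = inverse b)"
    by (simp add: torus_point_in_line_iff)
  then show "p \<in> {torus_point a b, torus_point a (inverse b)}"
    using uv(1) torus_point_inverse[of a b] torus_point_inverse[of a "inverse b"] by auto
qed

lemma torus_point_in_own_line:
  "torus_point a b \<in> vertical_line (a + inverse a) (b + inverse b)"
  "torus_point a (inverse b) \<in> vertical_line (a + inverse a) (b + inverse b)"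
  by (simp_all add: torus_point_def vertical_line_def)

section \<open>Unit complex numbers of argument a multiple of pi over d\<close>

definition phase :: "nat \<Rightarrow> int \<Rightarrow> complex" where
  "phase d k = cis (pi * of_int k / d)"

lemma phase_add: "phase d (k + l) = phase d k * phase d l"
  by (simp add: phase_def cis_mult algebra_simps add_divide_distrib)

lemma phase_uminus: "phase d (- k) = inverse (phase d k)"
  by (simp add: phase_def)

lemma phase_diff: "phase d (k - l) = phase d k / phase d l"
  by (simp add: phase_def cis_divide algebra_simps diff_divide_distrib)

lemma phase_nonzero [simp]: "phase d k \<noteq> 0"
  by (simp add: phase_def)

lemma phase_power: "phase d k ^ r = phase d (int r * k)"
  by (simp add: phase_def DeMoivre algebra_simps)

lemma phase_eq_1_iff:
  assumes "0 < d"
  shows "phase d k = 1 \<longleftrightarrow> 2 * int d dvd k"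
proof -
  have "phase d k = 1 \<longleftrightarrow> cos (pi * of_int k / d) = 1"
    by (auto simp: phase_def complex_eq_iff dest: cos_one_sin_zero)
  also have "\<dots> \<longleftrightarrow> (\<exists>x::int. pi * of_int k / d = of_int x * 2 * pi)"
    by (rule cos_one_2pi_int)
  also have "\<dots> \<longleftrightarrow> (\<exists>x::int. k = 2 * int d * x)"
  proof (rule ex_cong1)
    fix x :: int
    have "pi * of_int k / d = of_int x * 2 * pi \<longleftrightarrow> (of_int k :: real) = of_int (2 * int d * x)"
      using assms by (simp add: field_simps)
    then show "pi * of_int k / d = of_int x * 2 * pi \<longleftrightarrow> k = 2 * int d * x"
      by (simp only: of_int_eq_iff)
  qed
  finally show ?thesis by (simp add: dvd_def)
qed

lemma phase_eq_iff:
  assumes "0 < d"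
  shows "phase d k = phase d l \<longleftrightarrow> 2 * int d dvd k - l"
  using phase_eq_1_iff[OF assms, of "k - l"] by (simp add: phase_diff)

lemma phase_self: "0 < d \<Longrightarrow> phase d (int d) = -1"
  by (simp add: phase_def)

lemma phase_0: "phase d 0 = 1"
  by (simp add: phase_def)

lemma even_phase_power: "0 < d \<Longrightarrow> even k \<Longrightarrow> phase d k ^ d = 1"
  by (simp add: phase_power phase_eq_1_iff mult.commute)

lemma phase_square_eq_1_iff: "0 < d \<Longrightarrow> phase d k ^ 2 = 1 \<longleftrightarrow> int d dvd k"
  by (simp add: phase_power phase_eq_1_iff)

section \<open>Incidence of one line with the components\<close>

text \<open>The abbreviations \<open>p\<close> and \<open>q\<close> are the two roots of unity, determined up to inversion, that name the
  components through the two points of the line.\<close>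

locale indexed_line =
  fixes M N d i j :: nat
  assumes pos: "0 < M" "0 < N" "0 < d"
    and ij: "(i, j) \<in> index_pairs (M * d) (N * d)"
begin

abbreviation "curve \<equiv> C_component M N"
abbreviation "all_curves \<equiv> \<Union>\<xi>\<in>{\<xi>. \<xi>^d = 1}. curve \<xi>"
abbreviation "the_line \<equiv> node_line (M * d) (N * d) (i, j)"
abbreviation "p \<equiv> phase d (int i - int j)"
abbreviation "q \<equiv> phase d (int i + int j)"

text \<open>With \<open>a\<close>, \<open>b\<close> of arguments \<open>\<pi> i / (M d)\<close> and \<open>\<pi> j / (N d)\<close>, the quotients \<open>a\<^sup>M / b\<^sup>N\<close> and \<open>a\<^sup>M / b\<^sup>-\<^sup>N\<close> have
  arguments \<open>\<pi> (i - j) / d\<close> and \<open>\<pi> (i + j) / d\<close>. They are \<open>d\<close>-th roots of unity because \<open>i\<close> and \<open>j\<close>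
  have the same parity, which puts both points on the union of the components.\<close>

lemma line_meets_components:
  obtains P Q where
    "P \<noteq> Q"
    "the_line \<inter> all_curves = {P, Q}"
    "\<And>\<xi>. P \<in> curve \<xi> \<longleftrightarrow> \<xi> \<in> {p, inverse p}"
    "\<And>\<xi>. Q \<in> curve \<xi> \<longleftrightarrow> \<xi> \<in> {q, inverse q}"
proof -
  define a where "a = cis (pi * i / (M * d))"
  define b where "b = cis (pi * j / (N * d))"
  have bounds: "0 < i" "i < M * d" "0 < j" "j < N * d" "even (i + j)"
    using ij by (auto simp: index_pairs_def)
  have ab: "a \<noteq> 0" "b \<noteq> 0" by (simp_all add: a_def b_def)
  have ab2: "a^2 \<noteq> 1" "b^2 \<noteq> 1"
    using cis_node_square[of i "M * d"] cis_node_square[of j "N * d"] bounds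
    by (simp_all add: a_def b_def)
  have b': "inverse b \<noteq> 0" "inverse b ^ 2 \<noteq> 1"
    using ab ab2 by (auto simp: power_inverse)
  have aM: "a^M = phase d i" and bN: "b^N = phase d j"
    using pos by (simp_all add: a_def b_def DeMoivre phase_def)
  have q: "a^M / b^N = p" "a^M / inverse b ^ N = q"
    by (simp_all add: aM bN phase_diff phase_add power_inverse divide_inverse)
  have line: "the_line = vertical_line (a + inverse a) (b + inverse b)"
    by (simp add: node_line_def node_def a_def b_def)
  let ?P = "torus_point a b" and ?Q = "torus_point a (inverse b)"
  have P: "?P \<in> curve \<xi> \<longleftrightarrow> \<xi> \<in> {p, inverse p}" for \<xi>
    using torus_point_in_component_iff[OF ab ab2] unfolding q(1)[symmetric] by blast
  have Q: "?Q \<in> curve \<xi> \<longleftrightarrow> \<xi> \<in> {q, inverse q}" for \<xi>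
    using torus_point_in_component_iff[OF ab(1) b'(1) ab2(1) b'(2)] unfolding q(2)[symmetric] by blast
  have "p ^ d = 1" "q ^ d = 1"
    using bounds pos by (simp_all add: even_phase_power)
  then have "?P \<in> all_curves" "?Q \<in> all_curves"
    using P Q by blast+
  then have "the_line \<inter> all_curves = {?P, ?Q}"
    unfolding line
    using line_inter_component_subset[OF ab, of M N] torus_point_in_own_line[of a b] by blast
  from that[OF torus_point_flip_neq[OF ab ab2] this P Q] show thesis .
qed

lemma meets_twice_iff:
  "meets_twice all_curves the_line (curve \<xi>) \<longleftrightarrow> \<xi> \<in> {p, inverse p} \<and> \<xi> \<in> {q, inverse q}"
proof -
  obtain P Q where PQ: "P \<noteq> Q" "the_line \<inter> all_curves = {P, Q}"
    and mem: "\<And>\<xi>. P \<in> curve \<xi> \<longleftrightarrow> \<xi> \<in> {p, inverse p}"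
    "\<And>\<xi>. Q \<in> curve \<xi> \<longleftrightarrow> \<xi> \<in> {q, inverse q}"
    using line_meets_components by blast
  have "meets_twice all_curves the_line (curve \<xi>) \<longleftrightarrow> P \<in> curve \<xi> \<and> Q \<in> curve \<xi>"
    unfolding meets_twice_def PQ(2) using PQ(1) doubleton_eq_iff[of P Q] by metis
  then show ?thesis by (simp add: mem)
qed

text \<open>Whether two components are equal as sets is decided by the line itself: the curves of \<open>\<xi>\<close> and
  \<open>1/\<xi>\<close> coincide by inverting both parameters, and otherwise a point of the line lies on only one
  of the two curves.\<close>

lemma meets_pair_iff:
  "meets_pair all_curves the_line (curve \<xi>) (curve \<eta>) \<longleftrightarrow>
    \<eta> \<noteq> \<xi> \<and> \<eta> \<noteq> inverse \<xi> \<and>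
    (\<xi> \<in> {p, inverse p} \<and> \<eta> \<in> {q, inverse q}
   \<or> \<eta> \<in> {p, inverse p} \<and> \<xi> \<in> {q, inverse q})"
    (is "_ \<longleftrightarrow> ?R")
proof -
  obtain P Q where PQ: "P \<noteq> Q" "the_line \<inter> all_curves = {P, Q}"
    and mem: "\<And>\<xi>. P \<in> curve \<xi> \<longleftrightarrow> \<xi> \<in> {p, inverse p}"
    "\<And>\<xi>. Q \<in> curve \<xi> \<longleftrightarrow> \<xi> \<in> {q, inverse q}"
    using line_meets_components by blast
  have inv: "curve (inverse \<xi>) = curve \<xi>" if "\<xi> \<noteq> 0" for \<xi>
  proof -
    have *: "torus_point u v \<in> curve (inverse \<xi>)"
      if "u \<noteq> 0" "v \<noteq> 0" "u^M = \<xi> * v^N" for u v \<xi>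
      unfolding C_component_eq mem_Collect_eq
      using that torus_point_inverse[of u v]
      by (intro exI[of _ "inverse u"] exI[of _ "inverse v"]) (auto simp: power_inverse)
    have "curve \<xi> \<subseteq> curve (inverse \<xi>)" for \<xi>
      using * by (auto simp: C_component_eq[of M N \<xi>])
    from this[of \<xi>] this[of "inverse \<xi>"] show ?thesis by simp
  qed
  have "meets_pair all_curves the_line (curve \<xi>) (curve \<eta>) \<longleftrightarrow>
    curve \<xi> \<noteq> curve \<eta> \<and> (P \<in> curve \<xi> \<and> Q \<in> curve \<eta> \<or> P \<in> curve \<eta> \<and> Q \<in> curve \<xi>)"
    unfolding meets_pair_def PQ(2) using PQ(1) doubleton_eq_iff[of P Q] by metis
  also have "\<dots> \<longleftrightarrow> ?R"
  proof
    assume L: "curve \<xi> \<noteq> curve \<eta> \<and> (P \<in> curve \<xi> \<and> Q \<in> curve \<eta> \<or> P \<in> curve \<eta> \<and> Q \<in> curve \<xi>)"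
    then have "\<xi> \<noteq> 0" by (auto simp: mem)
    with L inv have "\<eta> \<noteq> \<xi> \<and> \<eta> \<noteq> inverse \<xi>" by auto
    with L show ?R by (simp add: mem)
  next
    assume R: ?R
    then have PQ: "P \<in> curve \<xi> \<and> Q \<in> curve \<eta> \<or> P \<in> curve \<eta> \<and> Q \<in> curve \<xi>"
      by (simp add: mem)
    moreover have "curve \<xi> \<noteq> curve \<eta>"
    proof
      assume eq: "curve \<xi> = curve \<eta>"
      with PQ have "P \<in> curve \<xi> \<and> P \<in> curve \<eta>" by auto
      then have "\<eta> = \<xi> \<or> \<eta> = inverse \<xi>" by (auto simp: mem)
      with R show False by blast
    qed
    ultimately show "curve \<xi> \<noteq> curve \<eta> \<and> (P \<in> curve \<xi> \<and> Q \<in> curve \<eta> \<or> P \<in> curve \<eta> \<and> Q \<in> curve \<xi>)"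
      by blast
  qed
  finally show ?thesis .
qed

end

section \<open>Powers of a primitive root of unity\<close>

text \<open>The roots other than 1 and, if \<open>d\<close> is even, other than -1. For odd \<open>d\<close> the condition on the square
  excludes 1 only, so this one set serves both parities.\<close>

definition nonreal_roots :: "nat \<Rightarrow> complex set" where
  "nonreal_roots d = {\<xi>. \<xi>^d = 1 \<and> \<xi>^2 \<noteq> 1}"

lemma primitive_root_power_eq_1_iff:
  assumes "0 < d" "primitive_root_of_unity d \<zeta>"
  shows "\<zeta>^k = 1 \<longleftrightarrow> d dvd k"
proof -
  have z: "\<zeta>^d = 1" "\<And>k. 0 < k \<Longrightarrow> k < d \<Longrightarrow> \<zeta>^k \<noteq> 1"
    using assms(2) by (auto simp: primitive_root_of_unity_def)
  have "\<zeta>^k = \<zeta>^(d * (k div d) + k mod d)" by simp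
  also have "\<dots> = \<zeta>^(k mod d)" by (simp only: power_add power_mult z power_one mult_1)
  finally have eq: "\<zeta>^k = \<zeta>^(k mod d)" .
  show ?thesis
  proof (cases "k mod d = 0")
    case False
    then have "\<zeta>^(k mod d) \<noteq> 1" using z(2)[of "k mod d"] assms(1) by simp
    with False eq show ?thesis by (simp add: dvd_eq_mod_eq_0)
  qed (use eq in auto)
qed

lemma primitive_root_powers:
  assumes "0 < d" "primitive_root_of_unity d \<zeta>"
  shows "(\<lambda>i. \<zeta>^i) ` {..<d} = {\<xi>. \<xi>^d = 1}"
proof (rule card_subset_eq)
  have z: "\<zeta>^d = 1" "\<zeta> \<noteq> 0"
    using assms by (auto simp: primitive_root_of_unity_def power_0_left)
  show "finite {\<xi>::complex. \<xi>^d = 1}" using assms(1) by (simp add: finite_roots_unity)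
  show "(\<lambda>i. \<zeta>^i) ` {..<d} \<subseteq> {\<xi>. \<xi>^d = 1}"
    using z by (auto simp flip: power_mult simp: mult.commute[of _ d] power_mult)
  have "i = j" if "i \<le> j" "j < d" "\<zeta>^i = \<zeta>^j" for i j
  proof -
    have "\<zeta>^j = \<zeta>^i * \<zeta>^(j - i)" using that(1) by (simp flip: power_add)
    with that(3) have "\<zeta>^i * 1 = \<zeta>^i * \<zeta>^(j - i)" by simp
    then have "\<zeta>^(j - i) = 1" using z by (subst (asm) mult_left_cancel) auto
    then have "d dvd j - i" using primitive_root_power_eq_1_iff[OF assms] by simp
    with that show ?thesis by (auto dest: dvd_imp_le)
  qed
  then have "inj_on (\<lambda>i. \<zeta>^i) {..<d}"
    by (intro inj_onI) (metis lessThan_iff nle_le)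
  then show "card ((\<lambda>i. \<zeta>^i) ` {..<d}) = card {\<xi>::complex. \<xi>^d = 1}"
    by (simp add: card_image card_roots_unity_eq[OF assms(1)])
qed

lemma dvd_double_iff:
  fixes i d :: nat
  assumes "i < d"
  shows "d dvd 2 * i \<longleftrightarrow> i = 0 \<or> even d \<and> i = d div 2"
proof
  assume "d dvd 2 * i"
  then obtain c where c: "2 * i = d * c" by blast
  with assms have "d * c < d * 2" by linarith
  then have "c < 2" by (metis mult_less_cancel1)
  then have "c = 0 \<or> c = 1" by auto
  with c show "i = 0 \<or> even d \<and> i = d div 2" by auto
qed auto

text \<open>The exponents \<open>i\<close> for which \<open>\<zeta>\<^sup>i\<close> is nonreal, if \<open>\<zeta>\<close> is a primitive \<open>d\<close>-th root of unity.\<close>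

lemma nonhalf_residues:
  fixes d :: nat
  shows "(if odd d then {1..<d} else {1..<d} - {d div 2}) = {i. i < d \<and> \<not> d dvd 2 * i}"
proof (rule set_eqI)
  fix i show "i \<in> (if odd d then {1..<d} else {1..<d} - {d div 2}) \<longleftrightarrow> i \<in> {i. i < d \<and> \<not> d dvd 2 * i}"
    by (cases "i < d") (simp_all add: dvd_double_iff Suc_le_eq)
qed

lemma primitive_root_nonreal_powers:
  assumes "0 < d" "primitive_root_of_unity d \<zeta>"
  shows "(\<lambda>i. \<zeta>^i) ` (if odd d then {1..<d} else {1..<d} - {d div 2}) = nonreal_roots d"
proof -
  have "(\<lambda>i. \<zeta>^i) ` (if odd d then {1..<d} else {1..<d} - {d div 2})
    = (\<lambda>i. \<zeta>^i) ` {i. i < d \<and> \<not> d dvd 2 * i}"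
    by (simp only: nonhalf_residues)
  also have "\<dots> = {\<xi> \<in> (\<lambda>i. \<zeta>^i) ` {..<d}. \<xi>^2 \<noteq> 1}"
  proof -
    have "(\<zeta>^i)^2 = 1 \<longleftrightarrow> d dvd 2 * i" for i
      using primitive_root_power_eq_1_iff[OF assms, of "i * 2"]
      by (simp only: power_mult mult.commute[of 2 i])
    then show ?thesis by auto
  qed
  also have "\<dots> = nonreal_roots d"
    unfolding primitive_root_powers[OF assms] nonreal_roots_def by blast
  finally show ?thesis .
qed

section \<open>Incidence in terms of divisibility\<close>

text \<open>The following predicates on an index pair express the incidence of its line with the components.
  A real \<open>d\<close>-th root of unity is encoded by its exponent \<open>e\<close> to the base \<open>exp (\<i> \<pi> / d)\<close>, which is 0 for
  the root 1 and \<open>d\<close> for the root -1; a congruence modulo \<open>2d\<close> is an equality of phases.\<close>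

definition both_at :: "nat \<Rightarrow> nat \<Rightarrow> nat \<times> nat \<Rightarrow> bool" where
  "both_at d e = (\<lambda>(i, j). 2 * int d dvd int i - int j - int e \<and> 2 * int d dvd int i + int j - int e)"

text \<open>The two points lie on the same component if \<open>p = q\<close> or \<open>p = 1/q\<close>, that is, if \<open>d\<close> divides \<open>j\<close> or \<open>i\<close>.
  That component belongs to a nonreal root exactly if \<open>d\<close> does not divide \<open>i\<close> and \<open>j\<close> both.\<close>

definition both_nonreal :: "nat \<Rightarrow> nat \<times> nat \<Rightarrow> bool" where
  "both_nonreal d = (\<lambda>(i, j). (d dvd i) \<noteq> (d dvd j))"

text \<open>If one of \<open>p\<close>, \<open>q\<close> is real, then the other is nonreal exactly if \<open>p\<^sup>2 q\<^sup>2\<close>, which has argument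
  \<open>4 \<pi> i / d\<close>, is not 1.\<close>

definition one_real :: "nat \<Rightarrow> nat \<Rightarrow> nat \<times> nat \<Rightarrow> bool" where
  "one_real d e = (\<lambda>(i, j). \<not> d dvd 2 * i \<and>
     (2 * int d dvd int i - int j - int e \<or> 2 * int d dvd int i + int j - int e))"

definition opposite_real :: "nat \<Rightarrow> nat \<times> nat \<Rightarrow> bool" where
  "opposite_real d = (\<lambda>(i, j).
     2 * int d dvd int i - int j \<and> 2 * int d dvd int i + int j - int d \<or>
     2 * int d dvd int i + int j \<and> 2 * int d dvd int i - int j - int d)"

definition distinct_nonreal :: "nat \<Rightarrow> nat \<times> nat \<Rightarrow> bool" where
  "distinct_nonreal d = (\<lambda>(i, j). \<not> int d dvd int i - int j \<and> \<not> int d dvd int i + int j \<and>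
     \<not> d dvd i \<and> \<not> d dvd j)"

lemma inverse_square_eq_1_iff: "(inverse \<xi>)^2 = 1 \<longleftrightarrow> (\<xi>::complex)^2 = 1"
  by (metis inverse_eq_1_iff power_inverse)

context indexed_line
begin

lemma p_q_roots: "p^d = 1" "q^d = 1"
  using ij pos by (auto simp: index_pairs_def even_phase_power)

lemma p_eq_q_iff: "p = q \<longleftrightarrow> d dvd j"
proof -
  have "p = q \<longleftrightarrow> 2 * int d dvd 2 * - int j"
    using pos by (simp add: phase_eq_iff algebra_simps)
  then show ?thesis by simp
qed

lemma p_eq_inverse_q_iff: "p = inverse q \<longleftrightarrow> d dvd i"
proof -
  have "p = inverse q \<longleftrightarrow> 2 * int d dvd 2 * int i"
    using pos by (simp add: phase_eq_iff flip: phase_uminus)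
  then show ?thesis by simp
qed

lemma real_phase:
  assumes "\<epsilon> = phase d (int e)" "e = 0 \<or> e = d"
  shows "\<epsilon>^2 = 1" "inverse \<epsilon> = \<epsilon>"
  using assms pos by (auto simp: phase_0 phase_self)

lemma meets_twice_real_iff:
  assumes "\<epsilon> = phase d (int e)" "e = 0 \<or> e = d"
  shows "meets_twice all_curves the_line (curve \<epsilon>) \<longleftrightarrow> both_at d e (i, j)"
proof -
  have *: "\<epsilon> \<in> {x, inverse x} \<longleftrightarrow> x = \<epsilon>" for x
    using real_phase(2)[OF assms] by (metis empty_iff insert_iff inverse_inverse_eq)
  show ?thesis
    unfolding meets_twice_iff *
    using assms(1) pos by (simp add: phase_eq_iff both_at_def)
qed

lemma meets_twice_nonreal_iff:
  "(\<exists>\<xi>\<in>nonreal_roots d. meets_twice all_curves the_line (curve \<xi>)) \<longleftrightarrow> both_nonreal d (i, j)"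
proof -
  have "(\<exists>\<xi>\<in>nonreal_roots d. meets_twice all_curves the_line (curve \<xi>)) \<longleftrightarrow>
    p^2 \<noteq> 1 \<and> (p = q \<or> p = inverse q)" (is "?L \<longleftrightarrow> ?R")
  proof
    assume ?L
    then obtain \<xi> where x: "\<xi>^2 \<noteq> 1" "\<xi> = p \<or> \<xi> = inverse p" "\<xi> = q \<or> \<xi> = inverse q"
      unfolding meets_twice_iff nonreal_roots_def by auto
    from x(1,2) have "p^2 \<noteq> 1" using inverse_square_eq_1_iff by blast
    moreover from x have "p = q \<or> p = inverse q" by (metis inverse_inverse_eq)
    ultimately show ?R by blast
  next
    assume ?R
    then show ?L
      unfolding meets_twice_iff nonreal_roots_def
      using p_q_roots by (intro bexI[of _ p]) auto
  qed
  also have "\<dots> \<longleftrightarrow> \<not> int d dvd int i - int j \<and> (d dvd i \<or> d dvd j)"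
    using pos by (auto simp: phase_square_eq_1_iff p_eq_q_iff p_eq_inverse_q_iff)
  also have "\<dots> \<longleftrightarrow> both_nonreal d (i, j)"
  proof (cases "d dvd i")
    case True
    then have "int d dvd int i - int j \<longleftrightarrow> d dvd j" by (simp add: dvd_diff_right_iff)
    with True show ?thesis by (simp add: both_nonreal_def)
  next
    case False
    then have "d dvd j \<Longrightarrow> \<not> int d dvd int i - int j" by (simp add: dvd_diff_left_iff)
    with False show ?thesis by (auto simp: both_nonreal_def)
  qed
  finally show ?thesis .
qed

lemma meets_pair_real_nonreal_iff:
  assumes "\<epsilon> = phase d (int e)" "e = 0 \<or> e = d"
  shows "(\<exists>\<xi>\<in>nonreal_roots d. meets_pair all_curves the_line (curve \<epsilon>) (curve \<xi>)) \<longleftrightarrow>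
    one_real d e (i, j)"
proof -
  have *: "\<epsilon> \<in> {x, inverse x} \<longleftrightarrow> x = \<epsilon>" for x
    using real_phase(2)[OF assms] by (metis empty_iff insert_iff inverse_inverse_eq)
  have "(\<exists>\<xi>\<in>nonreal_roots d. meets_pair all_curves the_line (curve \<epsilon>) (curve \<xi>)) \<longleftrightarrow>
    p = \<epsilon> \<and> q^2 \<noteq> 1 \<or> q = \<epsilon> \<and> p^2 \<noteq> 1" (is "?L \<longleftrightarrow> ?R")
  proof
    assume ?L
    then obtain \<xi> where "\<xi>^2 \<noteq> 1"
      "p = \<epsilon> \<and> (\<xi> = q \<or> \<xi> = inverse q) \<or> (\<xi> = p \<or> \<xi> = inverse p) \<and> q = \<epsilon>"
      unfolding meets_pair_iff * nonreal_roots_def by auto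
    then show ?R by (auto simp: inverse_square_eq_1_iff)
  next
    assume R: ?R
    have E: "\<xi> \<noteq> \<epsilon> \<and> \<xi> \<noteq> inverse \<epsilon>" if "\<xi>^2 \<noteq> 1" for \<xi>
      using that real_phase[OF assms] by auto
    from R show ?L
      unfolding meets_pair_iff * nonreal_roots_def
      using E p_q_roots by (elim disjE; intro bexI[of _ "if p = \<epsilon> \<and> q^2 \<noteq> 1 then q else p"]) auto
  qed
  also have "\<dots> \<longleftrightarrow> p = \<epsilon> \<and> \<not> d dvd 2 * i \<or> q = \<epsilon> \<and> \<not> d dvd 2 * i"
  proof -
    have "p * q = phase d (2 * int i)" by (simp flip: phase_add)
    then have pq: "p^2 * q^2 = phase d (2 * int i) ^ 2" by (metis power_mult_distrib)
    have "phase d (2 * int i) ^ 2 = 1 \<longleftrightarrow> d dvd 2 * i"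
      using pos phase_square_eq_1_iff[of d "2 * int i"]
      by (simp only:) (metis int_dvd_int_iff of_nat_mult of_nat_numeral)
    with pq have "p^2 * q^2 = 1 \<longleftrightarrow> d dvd 2 * i" by simp
    then show ?thesis using real_phase(1)[OF assms] by auto
  qed
  also have "\<dots> \<longleftrightarrow> one_real d e (i, j)"
    using assms(1) pos by (auto simp: phase_eq_iff one_real_def)
  finally show ?thesis .
qed

lemma meets_pair_1_minus_1_iff:
  "meets_pair all_curves the_line (curve 1) (curve (-1)) \<longleftrightarrow> opposite_real d (i, j)"
proof -
  have *: "1 \<in> {x, inverse x} \<longleftrightarrow> x = 1" "-1 \<in> {x, inverse x} \<longleftrightarrow> x = -1" for x :: complex
    by (metis inverse_1 inverse_inverse_eq insert_iff empty_iff)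
      (metis inverse_1 inverse_minus_eq inverse_inverse_eq insert_iff empty_iff)
  have "phase d k = -1 \<longleftrightarrow> 2 * int d dvd k - int d" for k
    using pos phase_eq_iff[of d k "int d"] by (simp add: phase_self)
  then show ?thesis
    unfolding meets_pair_iff * opposite_real_def using pos by (auto simp: phase_eq_1_iff)
qed

lemma meets_pair_nonreal_iff:
  "(\<exists>\<xi>\<in>nonreal_roots d. \<exists>\<eta>\<in>nonreal_roots d.
      meets_pair all_curves the_line (curve \<xi>) (curve \<eta>)) \<longleftrightarrow> distinct_nonreal d (i, j)"
proof -
  have "(\<exists>\<xi>\<in>nonreal_roots d. \<exists>\<eta>\<in>nonreal_roots d.
      meets_pair all_curves the_line (curve \<xi>) (curve \<eta>)) \<longleftrightarrow>
    p^2 \<noteq> 1 \<and> q^2 \<noteq> 1 \<and> p \<noteq> q \<and> p \<noteq> inverse q" (is "?L \<longleftrightarrow> ?R")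
  proof
    assume ?L
    then obtain \<xi> \<eta> where "\<xi>^2 \<noteq> 1" "\<eta>^2 \<noteq> 1" "\<eta> \<noteq> \<xi>" "\<eta> \<noteq> inverse \<xi>"
      "\<xi> \<in> {p, inverse p} \<and> \<eta> \<in> {q, inverse q} \<or> \<eta> \<in> {p, inverse p} \<and> \<xi> \<in> {q, inverse q}"
      unfolding meets_pair_iff nonreal_roots_def by auto
    then show ?R by (auto simp: inverse_square_eq_1_iff)
  next
    assume ?R
    moreover from this have "q \<noteq> inverse p" by auto
    ultimately show ?L
      unfolding meets_pair_iff nonreal_roots_def
      using p_q_roots by (intro bexI[of _ p] bexI[of _ q]) auto
  qed
  also have "\<dots> \<longleftrightarrow> distinct_nonreal d (i, j)"
    using pos by (auto simp: phase_square_eq_1_iff p_eq_q_iff p_eq_inverse_q_iff distinct_nonreal_def)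
  finally show ?thesis .
qed

end

section \<open>Counting index pairs\<close>

lemma card_blocks:
  fixes Q :: "nat \<Rightarrow> bool"
  assumes "\<And>b. b < B \<Longrightarrow> card {r. r < d \<and> Q (b * d + r)} = k"
  shows "card {x. x < B * d \<and> Q x} = B * k"
  using assms
proof (induction B)
  case (Suc B)
  have "{x. x < Suc B * d \<and> Q x} = {x. x < B * d \<and> Q x} \<union> (\<lambda>r. B * d + r) ` {r. r < d \<and> Q (B * d + r)}"
    (is "?A = ?B \<union> ?C")
  proof (intro equalityI subsetI)
    fix x assume x: "x \<in> ?A"
    show "x \<in> ?B \<union> ?C"
    proof (cases "x < B * d")
      case False
      then have "x = B * d + (x - B * d)" by simp
      with x False show ?thesis by (intro UnI2 image_eqI[of _ _ "x - B * d"]) auto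
    qed (use x in auto)
  qed auto
  moreover have "card (?B \<union> ?C) = card ?B + card ?C"
    by (rule card_Un_disjoint) auto
  moreover have "card ?C = k"
    using Suc.prems[of B] by (subst card_image) (auto simp: inj_on_def)
  ultimately show ?case using Suc by simp
qed simp

lemma card_even_below: "card {i. 0 < i \<and> i < n \<and> even i} = (n - 1) div 2"
proof -
  have "{i. 0 < i \<and> i < n \<and> even i} = (\<lambda>k. 2 * k) ` {1..(n - 1) div 2}"
    by (auto elim!: evenE)
  then show ?thesis by (simp add: card_image inj_on_def)
qed

lemma card_odd_below: "card {i. 0 < i \<and> i < n \<and> odd i} = n div 2"
proof -
  have "{i. 0 < i \<and> i < n \<and> odd i} = (\<lambda>k. 2 * k + 1) ` {..<n div 2}"
    by (auto elim!: oddE)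
  then show ?thesis by (simp add: card_image inj_on_def)
qed

lemma card_index_pairs:
  "card (index_pairs m n) = ((m - 1) div 2) * ((n - 1) div 2) + (m div 2) * (n div 2)"
proof -
  let ?E = "\<lambda>n. {i. 0 < i \<and> i < n \<and> even (i::nat)}" and ?O = "\<lambda>n. {i. 0 < i \<and> i < n \<and> odd (i::nat)}"
  have "index_pairs m n = ?E m \<times> ?E n \<union> ?O m \<times> ?O n"
    by (auto simp: index_pairs_def)
  moreover have "card \<dots> = card (?E m \<times> ?E n) + card (?O m \<times> ?O n)"
    by (intro card_Un_disjoint) (auto intro!: finite_cartesian_product)
  ultimately show ?thesis by (simp add: card_cartesian_product card_even_below card_odd_below)
qed

lemma card_multiples: 
  assumes "0 < (d::nat)"
  shows "card {i. 0 < i \<and> i < M * d \<and> d dvd i} = M - 1"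
proof -
  have "{i. 0 < i \<and> i < M * d \<and> d dvd i} = (\<lambda>a. d * a) ` {1..<M}"
    using assms by (auto elim!: dvdE simp: mult.commute)
  then show ?thesis using assms by (simp add: card_image inj_on_def)
qed

text \<open>A block contributes half of its \<open>d - 1\<close> nonmultiples if \<open>d\<close> is odd, whatever parity is asked for.
  If \<open>d\<close> is even, the classes have different sizes \<open>(d - 2) / 2\<close> and \<open>d / 2\<close>; the assumption on \<open>i\<close> selects
  the smaller one.\<close>

lemma card_nonmultiples_parity:
  assumes "0 < d" "even d \<Longrightarrow> even i"
  shows "card {j. 0 < j \<and> j < N * d \<and> \<not> d dvd j \<and> even (i + j)} = N * ((d - 1) div 2)"
proof -
  have "{j. 0 < j \<and> j < N * d \<and> \<not> d dvd j \<and> even (i + j)} = {j. j < N * d \<and> (\<not> d dvd j \<and> even (i + j))}"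
    by (auto intro: Nat.gr0I)
  also have "card \<dots> = N * ((d - 1) div 2)"
  proof (rule card_blocks)
    fix b
    have "{r. r < d \<and> \<not> d dvd b * d + r \<and> even (i + (b * d + r))}
      = {r. 0 < r \<and> r < d \<and> (even r \<longleftrightarrow> even (i + b * d))}"
      by (auto simp: dvd_add_right_iff dest: dvd_imp_le intro: Nat.gr0I)
    also have "card \<dots> = (d - 1) div 2"
    proof (cases "even (i + b * d)")
      case True
      then show ?thesis by (simp add: card_even_below)
    next
      case False
      then have "odd d" using assms(2) by auto
      with False show ?thesis by (auto simp: card_odd_below elim!: oddE)
    qed
    finally show "card {r. r < d \<and> \<not> d dvd b * d + r \<and> even (i + (b * d + r))} = (d - 1) div 2" .
  qed
  finally show ?thesis .
qed

lemma finite_below: "finite {j::nat. 0 < j \<and> j < n \<and> P j}"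
  by simp

lemma card_fibres:
  assumes "finite {i. P i}" "\<And>i. P i \<Longrightarrow> finite {j. Q i j}" "\<And>i. P i \<Longrightarrow> card {j. Q i j} = k"
  shows "card {(i, j). P i \<and> Q i j} = card {i. P i} * k"
proof -
  have "{(i, j). P i \<and> Q i j} = (SIGMA i:{i. P i}. {j. Q i j})" by auto
  also have "card \<dots> = (\<Sum>i\<in>{i. P i}. card {j. Q i j})"
    using assms(1,2) by (intro card_SigmaI) blast+
  also have "\<dots> = (\<Sum>i\<in>{i. P i}. k)"
    by (rule sum.cong) (simp_all add: assms(3))
  finally show ?thesis by simp
qed

lemma card_multiple_nonmultiple:
  assumes "0 < d"
  shows "card {(i, j) \<in> index_pairs (M * d) (N * d). d dvd i \<and> \<not> d dvd j} = (M - 1) * (N * ((d - 1) div 2))"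
proof -
  have eq: "{(i, j) \<in> index_pairs (M * d) (N * d). d dvd i \<and> \<not> d dvd j}
    = {(i, j). (0 < i \<and> i < M * d \<and> d dvd i) \<and>
       0 < j \<and> j < N * d \<and> \<not> d dvd j \<and> even (i + j)}"
    unfolding index_pairs_def by fast
  have "card {(i, j). (0 < i \<and> i < M * d \<and> d dvd i) \<and>
       0 < j \<and> j < N * d \<and> \<not> d dvd j \<and> even (i + j)} = card {i. 0 < i \<and> i < M * d \<and> d dvd i} * (N * ((d - 1) div 2))"
  proof (rule card_fibres)
    fix i assume "0 < i \<and> i < M * d \<and> d dvd i"
    then have "d dvd i" by blast
    then have "even d \<Longrightarrow> even i" by (rule dvd_trans[rotated])
    then show "card {j. 0 < j \<and> j < N * d \<and> \<not> d dvd j \<and> even (i + j)} = N * ((d - 1) div 2)"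
      by (rule card_nonmultiples_parity[OF assms])
  qed (rule finite_below)+
  then show ?thesis by (simp only: eq card_multiples[OF assms])
qed

lemma index_pairs_swap: "(i, j) \<in> index_pairs m n \<longleftrightarrow> (j, i) \<in> index_pairs n m"
  by (auto simp: index_pairs_def add.commute)

lemma card_both_nonreal:
  assumes "0 < d"
  shows "card {x \<in> index_pairs (M * d) (N * d). both_nonreal d x}
    = ((d - 1) div 2) * ((M - 1) * N + M * (N - 1))"
proof -
  let ?A = "\<lambda>M N. {(i, j) \<in> index_pairs (M * d) (N * d). d dvd i \<and> \<not> d dvd j}"
  have "{x \<in> index_pairs (M * d) (N * d). both_nonreal d x} = ?A M N \<union> prod.swap ` ?A N M"
    by (auto simp: both_nonreal_def index_pairs_swap[of _ _ "M * d"] image_iff)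
  moreover have "card \<dots> = card (?A M N) + card (prod.swap ` ?A N M)"
  proof (rule card_Un_disjoint)
    have "finite (?A M N)" for M N
      by (rule finite_subset[OF _ finite_index_pairs]) blast
    then show "finite (?A M N)" "finite (prod.swap ` ?A N M)" by blast+
  qed auto
  moreover have "card (prod.swap ` ?A N M) = card (?A N M)"
    by (rule card_image) (auto intro: inj_on_subset[OF inj_swap])
  ultimately show ?thesis
    by (simp add: card_multiple_nonmultiple[OF assms] distrib_left mult_ac)
qed

text \<open>A multiple of \<open>d\<close> in the given range is 0 or \<open>d\<close>, and it has to make up for the parity of \<open>x\<close>.\<close>

lemma double_dvd_small_offset:
  fixes x y :: int and d :: nat
  assumes y: "- int d < y" "y < 2 * int d"
  shows "2 * int d dvd int d * x + y \<longleftrightarrow> y = 0 \<and> even x \<or> y = int d \<and> odd x"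
proof
  assume D: "2 * int d dvd int d * x + y"
  have d: "0 < int d" using y by simp
  have "int d dvd (int d * x + y) - int d * x"
    using D by (intro dvd_diff) (auto dest: dvd_mult_right)
  then obtain z where z: "y = int d * z" by auto
  with y have "int d * -1 < int d * z" "int d * z < int d * 2" by linarith+
  then have "-1 < z" "z < 2" by (simp_all only: mult_less_cancel_left_pos[OF d])
  then have "z = 0 \<or> z = 1" by auto
  moreover have "int d * 2 dvd int d * (x + z)"
    using D by (simp add: z distrib_left mult.commute)
  then have "even (x + z)" using d by simp
  ultimately show "y = 0 \<and> even x \<or> y = int d \<and> odd x" using z by auto
next
  assume "y = 0 \<and> even x \<or> y = int d \<and> odd x"
  then show "2 * int d dvd int d * x + y"
  proof
    assume "y = int d \<and> odd x"
    then have "int d * x + y = int d * (x + 1)" "even (x + 1)"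
      by (simp_all add: distrib_left)
    then show ?thesis by (metis dvd_refl mult.commute mult_dvd_mono)
  qed (simp add: mult.commute)
qed

text \<open>Every block of length \<open>d\<close> contains exactly one solution. If \<open>c\<close> leaves the remainder \<open>c0\<close> modulo \<open>d\<close>,
  the solution is at position \<open>c0\<close> or \<open>d - c0\<close>, according to the parity of the block.\<close>

lemma card_congruent_up_to_sign:
  fixes c :: int
  assumes "0 < d" "\<not> int d dvd c"
  shows "card {j. 0 < j \<and> j < N * d \<and> (2 * int d dvd int j - c \<or> 2 * int d dvd int j + c)} = N"
proof -
  have c2: "\<not> 2 * int d dvd c"
    using assms(2) dvd_mult_right by blast
  have "0 < j" if "2 * int d dvd int j - c \<or> 2 * int d dvd int j + c" for j
    using that c2 by (intro Nat.gr0I) auto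
  then have "{j. 0 < j \<and> j < N * d \<and> (2 * int d dvd int j - c \<or> 2 * int d dvd int j + c)}
    = {j. j < N * d \<and> (2 * int d dvd int j - c \<or> 2 * int d dvd int j + c)}"
    by blast
  also have "card \<dots> = N * 1"
  proof (rule card_blocks)
    fix b
    define c0 q where "c0 = nat (c mod int d)" and "q = c div int d"
    have "0 \<le> c mod int d" "c mod int d < int d" "c mod int d \<noteq> 0"
      using assms by (simp_all add: dvd_eq_mod_eq_0)
    then have c0: "0 < c0" "c0 < d" "int c0 = c mod int d"
      unfolding c0_def by linarith+
    have c: "c = int d * q + int c0"
      by (simp add: c0(3) q_def)
    have m: "2 * int d dvd int (b * d + r) - c \<longleftrightarrow> r = c0 \<and> even (int b - q)" if "r < d" for r
    proof -
      have "int (b * d + r) - c = int d * (int b - q) + (int r - int c0)"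
        by (simp add: c right_diff_distrib)
      then have "2 * int d dvd int (b * d + r) - c \<longleftrightarrow>
          int r - int c0 = 0 \<and> even (int b - q) \<or> int r - int c0 = int d \<and> odd (int b - q)"
        using double_dvd_small_offset[of d "int r - int c0" "int b - q"] that c0(1,2)
        by (simp only:)
      also have "\<dots> \<longleftrightarrow> r = c0 \<and> even (int b - q)" using that by linarith
      finally show ?thesis .
    qed
    have p: "2 * int d dvd int (b * d + r) + c \<longleftrightarrow> r = d - c0 \<and> odd (int b - q)" if "r < d" for r
    proof -
      have "int (b * d + r) + c = int d * (int b + q) + (int r + int c0)"
        by (simp add: c distrib_left)
      then have "2 * int d dvd int (b * d + r) + c \<longleftrightarrow>
          int r + int c0 = 0 \<and> even (int b + q) \<or> int r + int c0 = int d \<and> odd (int b + q)"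
        using double_dvd_small_offset[of d "int r + int c0" "int b + q"] that c0(1,2)
        by (simp only:)
      also have "\<dots> \<longleftrightarrow> r = d - c0 \<and> odd (int b + q)" using c0(1,2) by linarith
      also have "odd (int b + q) \<longleftrightarrow> odd (int b - q)" by simp
      finally show ?thesis .
    qed
    have "r < d \<and> (2 * int d dvd int (b * d + r) - c \<or> 2 * int d dvd int (b * d + r) + c) \<longleftrightarrow>
      r = (if even (int b - q) then c0 else d - c0)" for r
    proof (cases "r < d")
      case True
      then show ?thesis by (simp only: m p) simp
    next
      case False
      moreover have "(if even (int b - q) then c0 else d - c0) < d" using c0(1,2) by simp
      ultimately show ?thesis by metis
    qed
    then have "{r. r < d \<and> (2 * int d dvd int (b * d + r) - c \<or> 2 * int d dvd int (b * d + r) + c)}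
      = {if even (int b - q) then c0 else d - c0}"
      by (simp only: singleton_conv)
    then show "card {r. r < d \<and> (2 * int d dvd int (b * d + r) - c \<or> 2 * int d dvd int (b * d + r) + c)} = 1"
      by simp
  qed
  finally show ?thesis by simp
qed

lemma card_not_half_multiples:
  assumes "0 < d"
  shows "card {i. 0 < i \<and> i < M * d \<and> \<not> d dvd 2 * i} = M * (2 * ((d - 1) div 2))"
proof -
  have "{i. 0 < i \<and> i < M * d \<and> \<not> d dvd 2 * i} = {i. i < M * d \<and> \<not> d dvd 2 * i}"
    by (auto intro: Nat.gr0I)
  also have "card \<dots> = M * (2 * ((d - 1) div 2))"
  proof (rule card_blocks)
    fix b
    have "d dvd 2 * (b * d + r) \<longleftrightarrow> d dvd 2 * r" for r
      by (simp add: distrib_left dvd_add_right_iff)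
    then have "{r. r < d \<and> \<not> d dvd 2 * (b * d + r)} = {r. r < d \<and> \<not> d dvd 2 * r}"
      by simp
    also have "\<dots> = (if odd d then {1..<d} else {1..<d} - {d div 2})"
      by (rule nonhalf_residues[symmetric])
    also have "card \<dots> = 2 * ((d - 1) div 2)"
      using assms by (auto elim!: evenE oddE simp: card_Diff_subset)
    finally show "card {r. r < d \<and> \<not> d dvd 2 * (b * d + r)} = 2 * ((d - 1) div 2)" .
  qed
  finally show ?thesis .
qed

text \<open>For fixed \<open>i\<close> the condition says that \<open>j\<close> is congruent to \<open>i + e\<close> or to \<open>- (i + e)\<close> modulo \<open>2d\<close>. This
  entails the parity condition on the index pair, so the number of \<open>j\<close> is the number of blocks.\<close>

lemma card_one_real:
  assumes "0 < d" "e = 0 \<or> e = d \<and> even d"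
  shows "card {x \<in> index_pairs (M * d) (N * d). one_real d e x} = ((d - 1) div 2) * (2 * M * N)"
proof -
  have *: "2 * int d dvd int i - int j - int e \<longleftrightarrow> 2 * int d dvd int j - (int i + int e)"
    "2 * int d dvd int i + int j - int e \<longleftrightarrow> 2 * int d dvd int j + (int i + int e)" for i j
  proof -
    have e: "2 * int d dvd 2 * int e" using assms(2) by auto
    have "2 * int d dvd int i - int j - int e \<longleftrightarrow> 2 * int d dvd - (int i - int j - int e) - 2 * int e"
      using e by (subst dvd_diff_left_iff) (simp_all only: dvd_minus_iff)
    then show "2 * int d dvd int i - int j - int e \<longleftrightarrow> 2 * int d dvd int j - (int i + int e)"
      by (simp add: algebra_simps)
    have "2 * int d dvd int i + int j - int e \<longleftrightarrow> 2 * int d dvd (int i + int j - int e) + 2 * int e"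
      using e by (subst dvd_add_left_iff) simp_all
    then show "2 * int d dvd int i + int j - int e \<longleftrightarrow> 2 * int d dvd int j + (int i + int e)"
      by (simp add: algebra_simps)
  qed
  have parity: "even (i + j)" if "2 * int d dvd int j - (int i + int e) \<or> 2 * int d dvd int j + (int i + int e)" for i j
  proof -
    from that have "even (int j - (int i + int e)) \<or> even (int j + (int i + int e))"
      by (auto dest: dvd_mult_left)
    moreover have "even e" using assms by auto
    ultimately show ?thesis by auto
  qed
  have eq: "{x \<in> index_pairs (M * d) (N * d). one_real d e x}
    = {(i, j). (0 < i \<and> i < M * d \<and> \<not> d dvd 2 * i) \<and>
        0 < j \<and> j < N * d \<and> (2 * int d dvd int j - (int i + int e) \<or> 2 * int d dvd int j + (int i + int e))}"
  proof -
    have "one_real d e (i, j) \<longleftrightarrow> \<not> d dvd 2 * i \<and>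
      (2 * int d dvd int j - (int i + int e) \<or> 2 * int d dvd int j + (int i + int e))" for i j
      by (simp only: one_real_def prod.case *)
    then show ?thesis
      unfolding index_pairs_def using parity by auto
  qed
  have "card {(i, j). (0 < i \<and> i < M * d \<and> \<not> d dvd 2 * i) \<and>
        0 < j \<and> j < N * d \<and> (2 * int d dvd int j - (int i + int e) \<or> 2 * int d dvd int j + (int i + int e))} = card {i. 0 < i \<and> i < M * d \<and> \<not> d dvd 2 * i} * N"
  proof (rule card_fibres)
    fix i assume "0 < i \<and> i < M * d \<and> \<not> d dvd 2 * i"
    then have "\<not> d dvd i" using dvd_mult[of d i 2] by blast
    then have "\<not> int d dvd int i" by simp
    then have "\<not> int d dvd int i + int e"
      using assms(2) by (elim disjE conjE) (simp_all only: of_nat_0 add_0_right dvd_add_triv_right_iff not_False_eq_True)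
    then show "card {j. 0 < j \<and> j < N * d \<and> (2 * int d dvd int j - (int i + int e) \<or> 2 * int d dvd int j + (int i + int e))} = N"
      by (rule card_congruent_up_to_sign[OF assms(1)])
  qed (rule finite_below)+
  then show ?thesis
    unfolding eq card_not_half_multiples[OF assms(1)] by (simp only: mult_ac)
qed

lemma card_odd_multiples_of_half:
  assumes "0 < h"
  shows "card {i. 0 < i \<and> i < M * (2 * h) \<and> i mod (2 * h) = h} = M"
proof -
  have "{i. 0 < i \<and> i < M * (2 * h) \<and> i mod (2 * h) = h} = {i. i < M * (2 * h) \<and> i mod (2 * h) = h}"
    using assms by (auto intro: Nat.gr0I)
  also have "card \<dots> = M * 1"
  proof (rule card_blocks)
    fix b
    have "{r. r < 2 * h \<and> (b * (2 * h) + r) mod (2 * h) = h} = {h}" using assms by auto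
    then show "card {r. r < 2 * h \<and> (b * (2 * h) + r) mod (2 * h) = h} = 1" by simp
  qed
  finally show ?thesis by simp
qed

text \<open>Adding and subtracting the two congruences shows that \<open>i\<close> and \<open>j\<close> are both congruent to \<open>d / 2\<close> modulo \<open>d\<close>.
  Conversely, for \<open>i = a d + d / 2\<close> and \<open>j = b d + d / 2\<close> the difference \<open>i - j\<close> is \<open>(a - b) d\<close> and the sum \<open>i + j\<close>
  is \<open>(a + b + 1) d\<close>, whose coefficients have different parities.\<close>

lemma card_opposite_real:
  assumes "0 < d" "even d"
  shows "card {x \<in> index_pairs (M * d) (N * d). opposite_real d x} = M * N"
proof -
  obtain h where h: "d = 2 * h" "0 < h" using assms by auto
  have char: "opposite_real d (i, j) \<and> even (i + j) \<longleftrightarrow> i mod d = h \<and> j mod d = h" for i j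
  proof
    assume "opposite_real d (i, j) \<and> even (i + j)"
    then have D: "2 * int d dvd int i - int j \<and> 2 * int d dvd int i + int j - int d \<or>
     2 * int d dvd int i + int j \<and> 2 * int d dvd int i - int j - int d"
      by (simp add: opposite_real_def)
    have "2 * int d dvd 2 * (int i - int h)" "2 * int d dvd 2 * (int j - int h) \<or> 2 * int d dvd 2 * - (int j + int h)"
    proof -
      have eq: "2 * (int i - int h) = (int i - int j) + (int i + int j - int d)"
        "2 * (int i - int h) = (int i + int j) + (int i - int j - int d)"
        "2 * (int j - int h) = (int i + int j - int d) - (int i - int j)"
        "2 * - (int j + int h) = (int i - int j - int d) - (int i + int j)"
        using h by simp_all
      from D show "2 * int d dvd 2 * (int i - int h)" using eq(1,2) by (metis dvd_add)
      from D show "2 * int d dvd 2 * (int j - int h) \<or> 2 * int d dvd 2 * - (int j + int h)"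
        unfolding eq(3,4) by (meson dvd_diff)
    qed
    then have "int d dvd int i - int h" "int d dvd int j - int h \<or> int d dvd int j + int h"
      by (simp_all only: dvd_mult_cancel_left dvd_minus_iff) simp_all
    moreover have "int d dvd int j - int h \<longleftrightarrow> int d dvd (int j - int h) + int d" by simp
    ultimately have "int d dvd int i - int h" "int d dvd int j - int h"
      using h by (simp_all add: algebra_simps)
    then have "int i mod int d = int h mod int d" "int j mod int d = int h mod int d"
      by (simp_all add: mod_eq_dvd_iff)
    then have "i mod d = h mod d" "j mod d = h mod d"
      by (simp_all only: of_nat_eq_iff flip: of_nat_mod)
    then show "i mod d = h \<and> j mod d = h"
      using h by simp
  next
    assume R: "i mod d = h \<and> j mod d = h"
    define a b where "a = int (i div d)" and "b = int (j div d)"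
    have "i = i div d * d + h" "j = j div d * d + h"
      using R by (metis div_mult_mod_eq)+
    then have "int i = a * int d + int h" "int j = b * int d + int h"
      unfolding a_def b_def by (metis of_nat_add of_nat_mult)+
    then have ij: "int i = a * (2 * int h) + int h" "int j = b * (2 * int h) + int h"
      using h(1) by simp_all
    have eqs: "int i - int j = int d * (a - b)" "int i + int j - int d = int d * (a + b)"
      "int i + int j = int d * (a + b + 1)" "int i - int j - int d = int d * (a - b - 1)"
      using h by (simp_all add: ij algebra_simps)
    have *: "2 * int d dvd int d * x \<longleftrightarrow> even x" for x
      using assms(1) by (simp only: mult.commute[of 2 "int d"]) simp
    have "2 * int d dvd int i - int j \<longleftrightarrow> even (a - b)"
      "2 * int d dvd int i + int j - int d \<longleftrightarrow> even (a + b)"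
      "2 * int d dvd int i + int j \<longleftrightarrow> even (a + b + 1)"
      "2 * int d dvd int i - int j - int d \<longleftrightarrow> even (a - b - 1)"
      using *[of "a - b"] *[of "a + b"] *[of "a + b + 1"] *[of "a - b - 1"]
      by (simp_all only: eqs[symmetric])
    then have "opposite_real d (i, j)"
      unfolding opposite_real_def prod.case by simp blast
    moreover have "even (int i + int j)" unfolding eqs using assms by simp
    then have "even (i + j)" by simp
    ultimately show "opposite_real d (i, j) \<and> even (i + j)" by blast
  qed
  have "{x \<in> index_pairs (M * d) (N * d). opposite_real d x}
    = {i. 0 < i \<and> i < M * d \<and> i mod d = h} \<times> {j. 0 < j \<and> j < N * d \<and> j mod d = h}"
    using char by (auto simp: index_pairs_def)
  then show ?thesis
    by (simp only: card_cartesian_product card_odd_multiples_of_half[OF h(2), folded h(1)])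
qed

text \<open>If \<open>m\<close> is odd, then the \<open>m - 1\<close> values of \<open>i\<close> are evenly distributed on the two parities, so every \<open>j\<close>
  has \<open>(m - 1) / 2\<close> partners.\<close>

lemma card_index_pairs_odd:
  assumes "odd m \<or> odd n" "0 < m" "0 < n"
  shows "2 * card (index_pairs m n) = (m - 1) * (n - 1)"
proof -
  have "2 * (((m - 1) div 2) * ((n - 1) div 2) + (m div 2) * (n div 2)) = (m - 1) * (n - 1)"
    if "odd m" "0 < n" for m n :: nat
  proof -
    obtain k where k: "m = 2 * k + 1" using \<open>odd m\<close> by (elim oddE)
    have "(n - 1) div 2 + n div 2 = n - 1" using that(2) by presburger
    then have "2 * k * ((n - 1) div 2 + n div 2) = 2 * k * (n - 1)" by simp
    then show ?thesis by (simp add: k distrib_left)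
  qed
  from this[of m n] this[of n m] assms show ?thesis
    unfolding card_index_pairs by (metis mult.commute)
qed

lemma both_at_iff:
  assumes "0 < d" "e = 0 \<or> e = d"
  shows "both_at d e (d * a, d * b) \<longleftrightarrow> (if e = 0 then even (a + b) else odd (a + b))"
proof -
  have *: "2 * int d dvd int d * x \<longleftrightarrow> even x" for x
    using assms(1) by (simp only: mult.commute[of 2 "int d"]) simp
  define c where "c = (if e = 0 then 0 else 1::int)"
  have "int e = int d * c" using assms(2) by (auto simp: c_def)
  then have "int (d * a) - int (d * b) - int e = int d * (int a - int b - c)"
    "int (d * a) + int (d * b) - int e = int d * (int a + int b - c)"
    by (simp_all add: algebra_simps)
  then have "both_at d e (d * a, d * b) \<longleftrightarrow> even (int a - int b - c) \<and> even (int a + int b - c)"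
    by (simp only: both_at_def prod.case *)
  also have "\<dots> \<longleftrightarrow> (if e = 0 then even (a + b) else odd (a + b))"
    by (auto simp: c_def)
  finally show ?thesis .
qed

lemma both_at_imp_multiples:
  assumes "both_at d e (i, j)" "e = 0 \<or> e = d"
  shows "d dvd i" "d dvd j"
proof -
  have D: "2 * int d dvd int i - int j - int e" "2 * int d dvd int i + int j - int e"
    using assms(1) by (simp_all add: both_at_def)
  have "2 * int d dvd 2 * (int i - int e)"
    using dvd_add[OF D] by (simp add: algebra_simps)
  then have "int d dvd int i - int e" by (simp only: dvd_mult_cancel_left) simp
  moreover have "int d dvd int e" using assms(2) by auto
  ultimately have "int d dvd int i" using dvd_add[of "int d" "int i - int e" "int e"] by simp
  then show "d dvd i" by simp
  have "2 * int d dvd 2 * int j"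
    using dvd_diff[OF D(2) D(1)] by simp
  then show "d dvd j" by simp
qed

text \<open>Such pairs are \<open>(d a, d b)\<close> with \<open>a + b\<close> even for the root 1 and odd for the root -1. One of the two
  parities is counted by \<open>card_index_pairs_odd\<close>; the other one has the same size, being the complement
  of half of all pairs \<open>(a, b)\<close>.\<close>

lemma card_both_at:
  assumes "0 < d" "e = 0 \<or> e = d \<and> even d" "odd M \<or> odd N" "0 < M" "0 < N"
  shows "2 * card {x \<in> index_pairs (M * d) (N * d). both_at d e x} = (M - 1) * (N - 1)"
proof -
  let ?G = "\<lambda>e::nat. {(a, b). 0 < a \<and> a < M \<and> 0 < b \<and> b < N \<and> (if e = 0 then even (a + b) else odd (a + b))}"
  let ?f = "\<lambda>(a, b). (d * a, d * b)"
  have e: "e = 0 \<or> e = d" using assms(2) by blast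
  have "{x \<in> index_pairs (M * d) (N * d). both_at d e x} = ?f ` ?G e"
  proof (intro equalityI subsetI)
    fix x assume x: "x \<in> {x \<in> index_pairs (M * d) (N * d). both_at d e x}"
    obtain i j where ij: "x = (i, j)" by fastforce
    with x have B: "both_at d e (i, j)" and P: "(i, j) \<in> index_pairs (M * d) (N * d)" by auto
    obtain a b where ab: "i = d * a" "j = d * b"
      using both_at_imp_multiples[OF B e] by blast
    have "0 < a \<and> a < M \<and> 0 < b \<and> b < N"
      using P assms(1) by (simp add: index_pairs_def ab mult.commute[of d])
    moreover have "if e = 0 then even (a + b) else odd (a + b)"
      using B both_at_iff[OF assms(1) e] by (simp only: ab)
    ultimately have "(a, b) \<in> ?G e" by blast
    then show "x \<in> ?f ` ?G e" by (rule rev_image_eqI) (simp add: ij ab)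
  next
    fix x assume "x \<in> ?f ` ?G e"
    then obtain z where z: "z \<in> ?G e" "x = ?f z" by blast
    obtain a b where zab: "z = (a, b)" by fastforce
    have x: "x = (d * a, d * b)" using z(2) by (simp only: zab prod.case)
    have "0 < a \<and> a < M \<and> 0 < b \<and> b < N \<and> (if e = 0 then even (a + b) else odd (a + b))"
      using z(1) unfolding zab mem_Collect_eq prod.case .
    then have ab: "0 < a" "a < M" "0 < b" "b < N"
      "if e = 0 then even (a + b) else odd (a + b)" by blast+
    have "both_at d e x" using ab(5) both_at_iff[OF assms(1) e] by (simp only: x)
    moreover have "even (d * a + d * b)" using ab(5) assms(1,2) by (auto split: if_splits)
    then have "x \<in> index_pairs (M * d) (N * d)"
      using ab(1-4) assms(1) by (simp add: index_pairs_def x mult.commute[of d])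
    ultimately show "x \<in> {x \<in> index_pairs (M * d) (N * d). both_at d e x}" by blast
  qed
  then have "card {x \<in> index_pairs (M * d) (N * d). both_at d e x} = card (?f ` ?G e)" by (simp only:)
  also have "\<dots> = card (?G e)"
    by (rule card_image) (use assms(1) in \<open>auto simp: inj_on_def\<close>)
  finally have card: "card {x \<in> index_pairs (M * d) (N * d). both_at d e x} = card (?G e)" .
  have G0: "?G 0 = index_pairs M N" by (simp add: index_pairs_def)
  show ?thesis
  proof (cases "e = 0")
    case True
    have "card {x \<in> index_pairs (M * d) (N * d). both_at d 0 x} = card (index_pairs M N)"
      using card unfolding True G0 .
    then show ?thesis
      unfolding True using card_index_pairs_odd[OF assms(3-5)] by (simp only:)
  next
    case False
    have "{1..<M} \<times> {1..<N} = ?G 0 \<union> ?G e" using False by auto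
    moreover have "card (?G 0 \<union> ?G e) = card (?G 0) + card (?G e)"
    proof (rule card_Un_disjoint)
      show "finite (?G 0)" unfolding G0 by (rule finite_index_pairs)
      show "finite (?G e)" by (rule finite_subset[of _ "{..<M} \<times> {..<N}"]) auto
      show "?G 0 \<inter> ?G e = {}" using False by auto
    qed
    ultimately have "card ({1..<M} \<times> {1..<N}) = card (?G 0) + card (?G e)" by metis
    then have "(M - 1) * (N - 1) = card (index_pairs M N) + card (?G e)"
      unfolding G0 by simp
    then show ?thesis
      unfolding card using card_index_pairs_odd[OF assms(3-5)] by linarith
  qed
qed

section \<open>The incidence classes partition the index pairs\<close>

text \<open>The partition is stated as an identity between truth values regarded as numbers, because this form
  can be summed over all index pairs.\<close>

lemma classes_partition:
  assumes "0 < d" "x \<in> index_pairs (M * d) (N * d)"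
  shows "of_bool (both_at d 0 x) + of_bool (both_at d d x) + of_bool (both_nonreal d x)
    + of_bool (opposite_real d x) + of_bool (one_real d 0 x) + of_bool (one_real d d x)
    + of_bool (distinct_nonreal d x) = (1::nat)"
proof -
  obtain i j where x: "x = (i, j)" by fastforce
  define p q where "p = int i - int j" and "q = int i + int j"
  define D where "D = int d"
  have D: "0 < D" using assms(1) by (simp add: D_def)
  have dvd_iff: "D dvd y \<longleftrightarrow> 2 * D dvd y \<or> 2 * D dvd y - D" for y
  proof
    assume "D dvd y"
    then obtain z where z: "y = D * z" by blast
    show "2 * D dvd y \<or> 2 * D dvd y - D"
    proof (cases "even z")
      case True
      then obtain w where "z = 2 * w" by blast
      then have "y = 2 * D * w" by (simp add: z)
      then show ?thesis by simp
    next
      case False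
      then obtain w where "z = 2 * w + 1" by (elim oddE)
      then have "y - D = 2 * D * w" by (simp add: z algebra_simps)
      then show ?thesis by simp
    qed
  next
    assume "2 * D dvd y \<or> 2 * D dvd y - D"
    then have "D dvd y \<or> D dvd y - D" using dvd_mult_right by blast
    then show "D dvd y" using dvd_add[of D "y - D" D] by auto
  qed
  have excl: "\<not> (2 * D dvd y \<and> 2 * D dvd y - D)" for y
  proof
    assume "2 * D dvd y \<and> 2 * D dvd y - D"
    then have "2 * D dvd D" using dvd_diff[of "2 * D" y "y - D"] by simp
    then have "2 * D \<le> D" using D by (rule zdvd_imp_le)
    with D show False by simp
  qed
  have ai: "d dvd i \<longleftrightarrow> D dvd int i" and aj: "d dvd j \<longleftrightarrow> D dvd int j"
    and d2i: "d dvd 2 * i \<longleftrightarrow> D dvd p + q"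
    unfolding D_def p_def q_def by (simp_all flip: int_dvd_int_iff)
  have T: "2 * D dvd p + q \<longleftrightarrow> d dvd i" "2 * D dvd q - p \<longleftrightarrow> d dvd j"
    unfolding D_def p_def q_def by simp_all
  have both: "2 * D dvd p - E \<and> 2 * D dvd q - E \<longrightarrow> d dvd i \<and> d dvd j" if "D dvd E" for E
  proof (intro impI, elim conjE)
    assume h: "2 * D dvd p - E" "2 * D dvd q - E"
    have "2 * D dvd 2 * E" using that by simp
    then have "2 * D dvd (p - E) + (q - E) + 2 * E" by (intro dvd_add h)
    moreover have "2 * D dvd (q - E) - (p - E)" by (intro dvd_diff h)
    ultimately show "d dvd i \<and> d dvd j" unfolding T[symmetric] by simp
  qed
  have both0: "2 * D dvd p \<and> 2 * D dvd q \<longrightarrow> d dvd i \<and> d dvd j"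
    using both[OF dvd_0_right] by (simp only: diff_0_right)
  have sum: "D dvd p \<longrightarrow> (D dvd q \<longleftrightarrow> d dvd 2 * i)" "D dvd q \<longrightarrow> (D dvd p \<longleftrightarrow> d dvd 2 * i)"
    unfolding d2i by (simp_all add: dvd_add_right_iff dvd_add_left_iff)
  have one: "D dvd p \<longrightarrow> (d dvd i \<longleftrightarrow> d dvd j)" "D dvd q \<longrightarrow> (d dvd i \<longleftrightarrow> d dvd j)"
    unfolding ai aj p_def q_def
    by (metis dvd_diff_left_iff dvd_diff_right_iff) (metis dvd_add_left_iff dvd_add_right_iff)
  have all: "d dvd i \<and> d dvd j \<longrightarrow> D dvd p \<and> D dvd q"
    unfolding ai aj p_def q_def by (simp add: dvd_add dvd_diff)
  have same: "d dvd j \<longrightarrow> (2 * D dvd p \<longleftrightarrow> 2 * D dvd q)"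
    unfolding T[symmetric] by (metis dvd_diff_left_iff dvd_diff_right_iff)
  have twice: "d dvd i \<longrightarrow> d dvd 2 * i" by simp
  note hyps = conjI[OF excl[of p] conjI[OF excl[of q] conjI[OF both0 conjI[OF both[OF dvd_refl]
    conjI[OF sum(1) conjI[OF sum(2) conjI[OF one(1) conjI[OF one(2) conjI[OF all conjI[OF same twice]]]]]]]]]]
  \<comment> \<open>The rest is propositional: \<open>p0\<close>, \<open>pd\<close> stand for \<open>p\<close> being congruent to 0, to \<open>d\<close> modulo \<open>2d\<close>,
    likewise \<open>q0\<close>, \<open>qd\<close>; \<open>a\<close>, \<open>b\<close>, \<open>c\<close> for \<open>d\<close> dividing \<open>i\<close>, \<open>j\<close>, \<open>2i\<close>. All 128 cases are evaluated.\<close>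
  have "\<forall>p0 pd q0 qd a b c. \<not> (p0 \<and> pd) \<and> \<not> (q0 \<and> qd)
      \<and> (p0 \<and> q0 \<longrightarrow> a \<and> b) \<and> (pd \<and> qd \<longrightarrow> a \<and> b)
      \<and> (p0 \<or> pd \<longrightarrow> (q0 \<or> qd \<longleftrightarrow> c)) \<and> (q0 \<or> qd \<longrightarrow> (p0 \<or> pd \<longleftrightarrow> c))
      \<and> (p0 \<or> pd \<longrightarrow> (a \<longleftrightarrow> b)) \<and> (q0 \<or> qd \<longrightarrow> (a \<longleftrightarrow> b))
      \<and> (a \<and> b \<longrightarrow> (p0 \<or> pd) \<and> (q0 \<or> qd))
      \<and> (b \<longrightarrow> (p0 \<longleftrightarrow> q0)) \<and> (a \<longrightarrow> c) \<longrightarrow>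
    of_bool (p0 \<and> q0) + of_bool (pd \<and> qd) + of_bool (a \<noteq> b)
      + of_bool (p0 \<and> qd \<or> q0 \<and> pd) + of_bool (\<not> c \<and> (p0 \<or> q0)) + of_bool (\<not> c \<and> (pd \<or> qd))
      + of_bool (\<not> (p0 \<or> pd) \<and> \<not> (q0 \<or> qd) \<and> \<not> a \<and> \<not> b) = (1::nat)"
    by (simp only: all_bool_eq) simp
  note this[rule_format, OF hyps[unfolded dvd_iff[of p] dvd_iff[of q]]]
  then show ?thesis
    unfolding x both_at_def both_nonreal_def opposite_real_def one_real_def distinct_nonreal_def prod.case
      p_def[symmetric] q_def[symmetric] D_def[symmetric] of_nat_0 diff_0_right
      dvd_iff[of p] dvd_iff[of q] .
qed

lemma card_classes:
  fixes M N d :: nat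
  assumes "0 < d"
  defines "n \<equiv> \<lambda>\<phi>. card {x \<in> index_pairs (M * d) (N * d). \<phi> x}"
  shows "card (index_pairs (M * d) (N * d)) =
    n (both_at d 0) + n (both_at d d) + n (both_nonreal d) + n (opposite_real d)
    + n (one_real d 0) + n (one_real d d) + n (distinct_nonreal d)"
proof -
  let ?P = "index_pairs (M * d) (N * d)"
  have n: "n \<phi> = (\<Sum>x\<in>?P. of_bool (\<phi> x))" for \<phi>
    unfolding n_def using finite_index_pairs[of "M * d" "N * d"]
    by (simp add: of_bool_def sum.If_cases Int_def)
  have "card ?P = (\<Sum>x\<in>?P. 1)" by simp
  also have "\<dots> = (\<Sum>x\<in>?P. of_bool (both_at d 0 x) + of_bool (both_at d d x) + of_bool (both_nonreal d x)
    + of_bool (opposite_real d x) + of_bool (one_real d 0 x) + of_bool (one_real d d x)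
    + of_bool (distinct_nonreal d x))"
    by (rule sum.cong) (simp_all only: classes_partition[OF assms(1)])
  finally show ?thesis by (simp only: n sum.distrib)
qed

text \<open>Since \<open>i - j\<close> and \<open>i + j\<close> are even, neither is congruent to an odd \<open>d\<close> modulo \<open>2d\<close>.\<close>

lemma odd_no_minus_one:
  assumes "odd d" "x \<in> index_pairs (M * d) (N * d)"
  shows "\<not> both_at d d x" "\<not> opposite_real d x" "\<not> one_real d d x"
proof -
  obtain i j where x: "x = (i, j)" by fastforce
  have "odd (int i - int j - int d)" "odd (int i + int j - int d)"
    using assms by (auto simp: x index_pairs_def)
  then have "\<not> 2 * int d dvd int i - int j - int d" "\<not> 2 * int d dvd int i + int j - int d"
    using dvd_mult_left by blast+
  then show "\<not> both_at d d x" "\<not> opposite_real d x" "\<not> one_real d d x"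
    by (auto simp: x both_at_def opposite_real_def one_real_def)
qed

lemma real_choose_2: "real (n choose 2) = real n * (real n - 1) / 2"
proof (induction n)
  case (Suc n)
  have "Suc n choose 2 = n + (n choose 2)" by (simp add: numeral_2_eq_2)
  with Suc show ?case by (simp add: field_simps)
qed simp

text \<open>This class is not counted directly: its size is the number of all index pairs minus the sizes of
  the other six classes.\<close>

lemma card_distinct_nonreal:
  assumes "0 < d" "odd M \<or> odd N" "0 < M" "0 < N"
  shows "real (card {x \<in> index_pairs (M * d) (N * d). distinct_nonreal d x})
    = real (((d - 1) div 2) choose 2) * (4 * real M * real N)"
proof -
  let ?n = "\<lambda>\<phi>. card {x \<in> index_pairs (M * d) (N * d). \<phi> x}"
  define D where "D = (d - 1) div 2"
  have sum: "real (card (index_pairs (M * d) (N * d))) =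
    real (?n (both_at d 0)) + real (?n (both_at d d)) + real (?n (both_nonreal d)) + real (?n (opposite_real d))
    + real (?n (one_real d 0)) + real (?n (one_real d d)) + real (?n (distinct_nonreal d))"
    using card_classes[OF assms(1), of M N] by simp
  have M: "real (M - 1) = real M - 1" and N: "real (N - 1) = real N - 1"
    using assms by (simp_all add: of_nat_diff)
  have b0: "2 * real (?n (both_at d 0)) = (real M - 1) * (real N - 1)"
    using card_both_at[OF assms(1) _ assms(2-4), of 0] unfolding M[symmetric] N[symmetric]
    by (simp flip: of_nat_mult)
  have bn: "real (?n (both_nonreal d)) = real D * ((real M - 1) * real N + real M * (real N - 1))"
    unfolding M[symmetric] N[symmetric]
    by (simp only: card_both_nonreal[OF assms(1)] D_def of_nat_mult of_nat_add)
  have o0: "real (?n (one_real d 0)) = real D * (2 * real M * real N)"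
    using card_one_real[OF assms(1), of 0 M N] by (simp add: D_def)
  have "real (?n (distinct_nonreal d)) = real D * (real D - 1) / 2 * (4 * real M * real N)"
  proof (cases "odd d")
    case True
    then have d: "real d = 2 * real D + 1" by (auto simp: D_def elim!: oddE)
    have zero: "?n (both_at d d) = 0" "?n (opposite_real d) = 0" "?n (one_real d d) = 0"
      using odd_no_minus_one[OF True, of _ M N] by (auto simp: card_eq_0_iff)
    have "2 * card (index_pairs (M * d) (N * d)) = (M * d - 1) * (N * d - 1)"
      using assms True by (intro card_index_pairs_odd) auto
    moreover have "real (M * d - 1) = real M * real d - 1" "real (N * d - 1) = real N * real d - 1"
      using assms by (simp_all add: of_nat_diff Suc_le_eq)
    ultimately have "2 * real (card (index_pairs (M * d) (N * d))) = (real M * real d - 1) * (real N * real d - 1)"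
      by (metis of_nat_mult of_nat_numeral)
    with sum b0 bn o0 zero show ?thesis
      by (simp add: d field_simps)
  next
    case False
    then obtain h where h: "d = 2 * h" by blast
    have "D + 1 = h" using assms(1) unfolding D_def h by presburger
    then have hD: "real h = real D + 1" by linarith
    have bd: "2 * real (?n (both_at d d)) = (real M - 1) * (real N - 1)"
      using card_both_at[OF assms(1) _ assms(2-4), of d] False unfolding M[symmetric] N[symmetric]
      by (simp flip: of_nat_mult)
    have od: "real (?n (one_real d d)) = real D * (2 * real M * real N)"
      using card_one_real[OF assms(1), of d M N] False by (simp add: D_def)
    have op: "real (?n (opposite_real d)) = real M * real N"
      using card_opposite_real[OF assms(1), of M N] False by simp
    have "(M * d - 1) div 2 = M * h - 1" "(N * d - 1) div 2 = N * h - 1" "M * d div 2 = M * h" "N * d div 2 = N * h"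
      using assms by (auto simp: h)
    then have "card (index_pairs (M * d) (N * d)) = (M * h - 1) * (N * h - 1) + (M * h) * (N * h)"
      by (simp only: card_index_pairs)
    moreover have "real (M * h - 1) = real M * real h - 1" "real (N * h - 1) = real N * real h - 1"
      using assms by (simp_all add: of_nat_diff Suc_le_eq h)
    ultimately have "real (card (index_pairs (M * d) (N * d)))
      = (real M * real h - 1) * (real N * real h - 1) + real M * real h * (real N * real h)"
      by (simp only: of_nat_add of_nat_mult)
    with sum b0 bn o0 bd od op show ?thesis
      by (simp add: hD field_simps)
  qed
  then show ?thesis by (simp only: real_choose_2 D_def)
qed

section \<open>Counting lines\<close>

lemma card_straight_lines_filter:
  assumes "0 < m" "0 < n"
    and "\<And>i j. (i, j) \<in> index_pairs m n \<Longrightarrow> \<Phi> (node_line m n (i, j)) \<longleftrightarrow> \<phi> (i, j)"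
  shows "card {l \<in> straight_lines m n. \<Phi> l} = card {x \<in> index_pairs m n. \<phi> x}"
proof -
  have "{l \<in> straight_lines m n. \<Phi> l} = node_line m n ` {x \<in> index_pairs m n. \<phi> x}"
    unfolding straight_lines_eq[OF assms(1,2)] using assms(3) by auto
  then have "card {l \<in> straight_lines m n. \<Phi> l} = card (node_line m n ` {x \<in> index_pairs m n. \<phi> x})"
    by (rule arg_cong)
  also have "\<dots> = card {x \<in> index_pairs m n. \<phi> x}"
    by (rule card_image) (rule inj_on_subset[OF inj_on_node_line Collect_restrict])
  finally show ?thesis .
qed

theorem theorem5p9:
  fixes m n d m' n' :: nat and \<zeta> :: complex
  assumes "n \<le> m" and "0 < n"
    and "d = gcd m n" and "m = m' * d" and "n = n' * d"
    and "primitive_root_of_unity d \<zeta>"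
  shows
    "let S = straight_lines m n;
         K = C_component m' n';
         C = (\<Union>i<d. K (\<zeta> ^ i))
     in finite S \<and>
       (odd d \<longrightarrow>
          real (card S) =
              (real m' - 1) * (real n' - 1) / 2
            + (real d - 1) / 2 * ((real m' - 1) * real n' + real m' * (real n' - 1))
            + (real d - 1) / 2 * (2 * real m' * real n')
            + real (((d - 1) div 2) choose 2) * (4 * real m' * real n')
        \<and> real (card {l \<in> S. meets_twice C l (K 1)}) =
              (real m' - 1) * (real n' - 1) / 2
        \<and> real (card {l \<in> S. \<exists>i\<in>{1..<d}. meets_twice C l (K (\<zeta> ^ i))}) =
              (real d - 1) / 2 * ((real m' - 1) * real n' + real m' * (real n' - 1))
        \<and> real (card {l \<in> S. \<exists>i\<in>{1..<d}. meets_pair C l (K 1) (K (\<zeta> ^ i))}) =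
              (real d - 1) / 2 * (2 * real m' * real n')
        \<and> real (card {l \<in> S. \<exists>i\<in>{1..<d}. \<exists>j\<in>{1..<d}.
                                meets_pair C l (K (\<zeta> ^ i)) (K (\<zeta> ^ j))}) =
              real (((d - 1) div 2) choose 2) * (4 * real m' * real n'))
     \<and> (even d \<longrightarrow>
          real (card S) =
              (real m' - 1) * (real n' - 1) / 2
            + (real m' - 1) * (real n' - 1) / 2
            + (real d - 2) / 2 * ((real m' - 1) * real n' + real m' * (real n' - 1))
            + real m' * real n'
            + (real d - 2) / 2 * (2 * real m' * real n')
            + (real d - 2) / 2 * (2 * real m' * real n')
            + real (((d - 2) div 2) choose 2) * (4 * real m' * real n')
        \<and> real (card {l \<in> S. meets_twice C l (K 1)}) =
              (real m' - 1) * (real n' - 1) / 2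
        \<and> real (card {l \<in> S. meets_twice C l (K (-1))}) =
              (real m' - 1) * (real n' - 1) / 2
        \<and> real (card {l \<in> S. \<exists>i\<in>{1..<d} - {d div 2}. meets_twice C l (K (\<zeta> ^ i))}) =
              (real d - 2) / 2 * ((real m' - 1) * real n' + real m' * (real n' - 1))
        \<and> real (card {l \<in> S. meets_pair C l (K 1) (K (-1))}) =
              real m' * real n'
        \<and> real (card {l \<in> S. \<exists>i\<in>{1..<d} - {d div 2}. meets_pair C l (K 1) (K (\<zeta> ^ i))}) =
              (real d - 2) / 2 * (2 * real m' * real n')
        \<and> real (card {l \<in> S. \<exists>i\<in>{1..<d} - {d div 2}. meets_pair C l (K (-1)) (K (\<zeta> ^ i))}) =
              (real d - 2) / 2 * (2 * real m' * real n')
        \<and> real (card {l \<in> S. \<exists>i\<in>{1..<d} - {d div 2}. \<exists>j\<in>{1..<d} - {d div 2}.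
                                meets_pair C l (K (\<zeta> ^ i)) (K (\<zeta> ^ j))}) =
              real (((d - 2) div 2) choose 2) * (4 * real m' * real n'))"
proof -
  define M N where "M = m'" and "N = n'"
  define P where "P = index_pairs (M * d) (N * d)"
  define S where "S = straight_lines m n"
  define K where "K = C_component M N"
  define C where "C = (\<Union>i<d. K (\<zeta> ^ i))"
  define D where "D = (d - 1) div 2"
  have m: "m = M * d" and n: "n = N * d"
    using assms(4,5) by (simp_all add: M_def N_def)
  have pos: "0 < M" "0 < N" "0 < d" and mn: "0 < m" "0 < n"
    using assms(1,2) by (auto simp: m n)
  have "d * gcd M N = d * 1"
    using assms(3) by (simp add: m n gcd_mult_distrib_nat mult.commute)
  then have "gcd M N = 1" using pos by (subst (asm) mult_left_cancel) auto
  then have odd: "odd M \<or> odd N"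
    using gcd_greatest[of 2 M N] by fastforce
  have C: "C = (\<Union>\<xi>\<in>{\<xi>. \<xi>^d = 1}. K \<xi>)"
    unfolding C_def primitive_root_powers[OF pos(3) assms(6), symmetric] by simp
  have bex: "(\<exists>i\<in>I. meets_twice C l (K (\<zeta> ^ i))) \<longleftrightarrow> (\<exists>\<xi>\<in>nonreal_roots d. meets_twice C l (K \<xi>))"
    "(\<exists>i\<in>I. meets_pair C l X (K (\<zeta> ^ i))) \<longleftrightarrow> (\<exists>\<xi>\<in>nonreal_roots d. meets_pair C l X (K \<xi>))"
    "(\<exists>i\<in>I. \<exists>j\<in>I. meets_pair C l (K (\<zeta> ^ i)) (K (\<zeta> ^ j))) \<longleftrightarrow>
      (\<exists>\<xi>\<in>nonreal_roots d. \<exists>\<eta>\<in>nonreal_roots d. meets_pair C l (K \<xi>) (K \<eta>))"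
    if "I = (if odd d then {1..<d} else {1..<d} - {d div 2})" for I l X
  proof -
    have "nonreal_roots d = (\<lambda>i. \<zeta> ^ i) ` I"
      unfolding that by (rule primitive_root_nonreal_powers[OF pos(3) assms(6), symmetric])
    then show "(\<exists>i\<in>I. meets_twice C l (K (\<zeta> ^ i))) \<longleftrightarrow> (\<exists>\<xi>\<in>nonreal_roots d. meets_twice C l (K \<xi>))"
      "(\<exists>i\<in>I. meets_pair C l X (K (\<zeta> ^ i))) \<longleftrightarrow> (\<exists>\<xi>\<in>nonreal_roots d. meets_pair C l X (K \<xi>))"
      "(\<exists>i\<in>I. \<exists>j\<in>I. meets_pair C l (K (\<zeta> ^ i)) (K (\<zeta> ^ j))) \<longleftrightarrow>
        (\<exists>\<xi>\<in>nonreal_roots d. \<exists>\<eta>\<in>nonreal_roots d. meets_pair C l (K \<xi>) (K \<eta>))"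
      by simp_all
  qed
  have count: "card {l \<in> S. \<Phi> l} = card {x \<in> P. \<phi> x}"
    if "\<And>i j. indexed_line M N d i j \<Longrightarrow> \<Phi> (node_line (M * d) (N * d) (i, j)) \<longleftrightarrow> \<phi> (i, j)" for \<Phi> \<phi>
    unfolding S_def P_def m n
    by (rule card_straight_lines_filter) (use mn m n pos that in \<open>auto simp: indexed_line_def\<close>)

  have S: "finite S" "card S = card P"
    using straight_lines_eq[OF mn] unfolding S_def P_def m n
    by (simp_all add: finite_index_pairs card_image inj_on_node_line)
  have eps: "(1::complex) = phase d (int 0)" "(-1::complex) = phase d (int d)"
    using pos by (simp_all add: phase_0 phase_self)
  have counts:
    "card {l \<in> S. meets_twice C l (K 1)} = card {x \<in> P. both_at d 0 x}"
    "card {l \<in> S. meets_twice C l (K (-1))} = card {x \<in> P. both_at d d x}"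
    "card {l \<in> S. \<exists>\<xi>\<in>nonreal_roots d. meets_twice C l (K \<xi>)} = card {x \<in> P. both_nonreal d x}"
    "card {l \<in> S. meets_pair C l (K 1) (K (-1))} = card {x \<in> P. opposite_real d x}"
    "card {l \<in> S. \<exists>\<xi>\<in>nonreal_roots d. meets_pair C l (K 1) (K \<xi>)} = card {x \<in> P. one_real d 0 x}"
    "card {l \<in> S. \<exists>\<xi>\<in>nonreal_roots d. meets_pair C l (K (-1)) (K \<xi>)} = card {x \<in> P. one_real d d x}"
    "card {l \<in> S. \<exists>\<xi>\<in>nonreal_roots d. \<exists>\<eta>\<in>nonreal_roots d. meets_pair C l (K \<xi>) (K \<eta>)}
      = card {x \<in> P. distinct_nonreal d x}"
    unfolding C K_def
    by (rule count, simp add: indexed_line.meets_twice_real_iff[OF _ eps(1)])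
      (rule count, simp add: indexed_line.meets_twice_real_iff[OF _ eps(2)],
       rule count, simp add: indexed_line.meets_twice_nonreal_iff,
       rule count, simp add: indexed_line.meets_pair_1_minus_1_iff,
       rule count, simp add: indexed_line.meets_pair_real_nonreal_iff[OF _ eps(1)],
       rule count, simp add: indexed_line.meets_pair_real_nonreal_iff[OF _ eps(2)],
       rule count, simp add: indexed_line.meets_pair_nonreal_iff)
  have M: "real (M - 1) = real M - 1" and N: "real (N - 1) = real N - 1"
    using pos by (simp_all add: of_nat_diff)
  have half: "real (card {x \<in> P. both_at d e x}) = (real M - 1) * (real N - 1) / 2"
    if "e = 0 \<or> e = d \<and> even d" for e
  proof -
    have "real (2 * card {x \<in> P. both_at d e x}) = real ((M - 1) * (N - 1))"
      unfolding P_def card_both_at[OF pos(3) that odd pos(1,2)] by (rule refl)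
    then show ?thesis unfolding of_nat_mult M N by simp
  qed
  have nonreal: "real (card {x \<in> P. both_nonreal d x}) = real D * ((real M - 1) * real N + real M * (real N - 1))"
    unfolding P_def M[symmetric] N[symmetric]
    by (simp only: card_both_nonreal[OF pos(3)] D_def of_nat_mult of_nat_add)
  have one: "real (card {x \<in> P. one_real d e x}) = real D * (2 * real M * real N)"
    if "e = 0 \<or> e = d \<and> even d" for e
    unfolding P_def card_one_real[OF pos(3) that] by (simp add: D_def)
  have distinct: "real (card {x \<in> P. distinct_nonreal d x}) = real (D choose 2) * (4 * real M * real N)"
    unfolding P_def D_def by (rule card_distinct_nonreal[OF pos(3) odd pos(1,2)])
  have total: "card P = card {x \<in> P. both_at d 0 x} + card {x \<in> P. both_at d d x}
    + card {x \<in> P. both_nonreal d x} + card {x \<in> P. opposite_real d x}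
    + card {x \<in> P. one_real d 0 x} + card {x \<in> P. one_real d d x} + card {x \<in> P. distinct_nonreal d x}"
    unfolding P_def by (rule card_classes[OF pos(3)])

  show ?thesis
    unfolding Let_def M_def[symmetric] N_def[symmetric] S_def[symmetric] K_def[symmetric] C_def[symmetric]
  proof (intro conjI impI S(1))
    assume d: "odd d"
    have D: "(real d - 1) / 2 = real D" "(d - 1) div 2 = D"
      using d by (auto simp: D_def elim!: oddE)
    have I: "{1..<d} = (if odd d then {1..<d} else {1..<d} - {d div 2})" using d by simp
    have zero: "card {x \<in> P. both_at d d x} = 0" "card {x \<in> P. opposite_real d x} = 0"
      "card {x \<in> P. one_real d d x} = 0"
      using odd_no_minus_one[OF d, of _ M N] by (auto simp: P_def card_eq_0_iff)
    show "real (card S) = (real M - 1) * (real N - 1) / 2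
        + (real d - 1) / 2 * ((real M - 1) * real N + real M * (real N - 1))
        + (real d - 1) / 2 * (2 * real M * real N)
        + real (((d - 1) div 2) choose 2) * (4 * real M * real N)"
      unfolding S(2) total zero of_nat_add D by (simp add: half nonreal one distinct)
    show "real (card {l \<in> S. meets_twice C l (K 1)}) = (real M - 1) * (real N - 1) / 2"
      by (simp add: counts half)
    show "real (card {l \<in> S. \<exists>i\<in>{1..<d}. meets_twice C l (K (\<zeta> ^ i))})
        = (real d - 1) / 2 * ((real M - 1) * real N + real M * (real N - 1))"
      unfolding bex(1)[OF I] counts D by (rule nonreal)
    show "real (card {l \<in> S. \<exists>i\<in>{1..<d}. meets_pair C l (K 1) (K (\<zeta> ^ i))})
        = (real d - 1) / 2 * (2 * real M * real N)"
      unfolding bex(2)[OF I] counts D by (rule one) simp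
    show "real (card {l \<in> S. \<exists>i\<in>{1..<d}. \<exists>j\<in>{1..<d}. meets_pair C l (K (\<zeta> ^ i)) (K (\<zeta> ^ j))})
        = real (((d - 1) div 2) choose 2) * (4 * real M * real N)"
      unfolding bex(3)[OF I] counts D by (rule distinct)
  next
    assume d: "even d"
    have D2: "d = 2 * D + 2"
      using d pos(3) unfolding D_def by presburger
    have D: "(real d - 2) / 2 = real D" "(d - 2) div 2 = D"
      by (simp_all add: D2)
    have I: "{1..<d} - {d div 2} = (if odd d then {1..<d} else {1..<d} - {d div 2})" using d by simp
    have opp: "real (card {x \<in> P. opposite_real d x}) = real M * real N"
      unfolding P_def by (simp add: card_opposite_real[OF pos(3) d])
    show "real (card S) = (real M - 1) * (real N - 1) / 2
        + (real M - 1) * (real N - 1) / 2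
        + (real d - 2) / 2 * ((real M - 1) * real N + real M * (real N - 1))
        + real M * real N
        + (real d - 2) / 2 * (2 * real M * real N)
        + (real d - 2) / 2 * (2 * real M * real N)
        + real (((d - 2) div 2) choose 2) * (4 * real M * real N)"
      unfolding S(2) total of_nat_add D by (simp add: half nonreal one distinct opp d)
    show "real (card {l \<in> S. meets_twice C l (K 1)}) = (real M - 1) * (real N - 1) / 2"
      "real (card {l \<in> S. meets_twice C l (K (-1))}) = (real M - 1) * (real N - 1) / 2"
      by (simp_all add: counts half d)
    show "real (card {l \<in> S. \<exists>i\<in>{1..<d} - {d div 2}. meets_twice C l (K (\<zeta> ^ i))})
        = (real d - 2) / 2 * ((real M - 1) * real N + real M * (real N - 1))"
      unfolding bex(1)[OF I] counts D by (rule nonreal)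
    show "real (card {l \<in> S. meets_pair C l (K 1) (K (-1))}) = real M * real N"
      unfolding counts by (rule opp)
    show "real (card {l \<in> S. \<exists>i\<in>{1..<d} - {d div 2}. meets_pair C l (K 1) (K (\<zeta> ^ i))})
        = (real d - 2) / 2 * (2 * real M * real N)"
      unfolding bex(2)[OF I] counts D by (rule one) simp
    show "real (card {l \<in> S. \<exists>i\<in>{1..<d} - {d div 2}. meets_pair C l (K (-1)) (K (\<zeta> ^ i))})
        = (real d - 2) / 2 * (2 * real M * real N)"
      unfolding bex(2)[OF I] counts D by (rule one) (simp add: d)
    show "real (card {l \<in> S. \<exists>i\<in>{1..<d} - {d div 2}. \<exists>j\<in>{1..<d} - {d div 2}.
        meets_pair C l (K (\<zeta> ^ i)) (K (\<zeta> ^ j))})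
        = real (((d - 2) div 2) choose 2) * (4 * real M * real N)"
      unfolding bex(3)[OF I] counts D by (rule distinct)
  qed
qed

end
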